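(* Consider Generalized Minimum Distance (GMD) decoding of an $\mathcal{RS}(n,k,d=n-k+1)$ code over $GF(q)$, with the basis polynomials $\Delta^{(1)}(x),\Delta^{(2)}(x)$ computed by the extended Euclidean algorithm from the syndrome, the integer $t_1$, and the matrix $\mathbf{A}$ of evaluations, all as described in the context. Apply to $\mathbf{A}$ the fundamental iterative algorithm (FIA), in the version that obtains all the solutions to all $2\tau\times(2\tau+1)$ submatrices situated in the upper left corner of $\mathbf{A}$, modified by the following choice of starting vectors. (Case $t_1=1$.) If $(a_1,a_2,a_3,\dots,a_{2i+1})$ solves the first $j$ equations of the upper left $2i\times(2i+1)$ subsystem, so that it represents a polynomial $\Lambda_1(x)$ with zeros $\alpha_1,\dots,\alpha_j$, then the padded vector $(0,a_1,0,a_2,a_3,\dots,a_{2i+1})$ of length $2i+3$ represents $x\cdot\Lambda_1(x)$ and hence fulfills the first $j$ equations of the upper left $(2i+2)\times(2i+3)$ subsystem. With this starting vector it suffices to start the examination of column $2i+3$ in row $j+1$. In general, in column $i$ the (padded) connection vector stored in column $i-2$ is taken as the starting vector, so connection vectors are stored separately for even and odd columns. (General $t_1$.) For columns $i=2,\dots,2t_1$ the starting vector is the connection vector stored in column $i-1$, padded with a zero in the first position; if that vector was stored for row $j$, the examination of column $i$ starts in row $j$. In column $2t_1+1$ the examination starts again in row $1$. For any later column $i$ the starting vector is the connection vector stored in column $i-2$, padded with zeros in positions $1$ and $2t_1+1$. For $t_1=1$ this is consistent with the previous description. With these starting vectors the matrix has to be traversed from top to bottom twice, whereas in the basic FIA it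 has to be traversed $\mathcal{O}(d)$ times. The complexity is thereby reduced from the $\mathcal{O}(d^3)$ of the basic FIA to $\mathcal{O}(d^2)$, so that the list of possible solutions (candidate error locator polynomials) for GMD decoding is found with complexity $\mathcal{O}(d^2)$.
   Context: Code: let $\alpha\in GF(q)$ have order $n$. Codewords are the $c(x)=c_0+\dots+c_{n-1}x^{n-1}$ over $GF(q)$ whose spectrum $C_j=c(\alpha^j)$, $j=0,\dots,n-1$, is zero for $j=0,\dots,d-2$. For a received word $r(x)=c(x)+e(x)$ with error $e(x)$ and spectrum $R(x)=\sum_j r(\alpha^j)x^j$, the syndrome is $S(x)=R(x)\bmod x^{d-1}$. GMD decoding: the decoder is given a list of positions sorted by reliability and makes several trials. In each trial a number of least reliable positions are erased, the least reliable being erased first. The polynomial $\Lambda(x)$ is a joint error and erasure locator: if position $p$ is erased, then $\Lambda(\alpha^{-p})=0$. Hence, if $\Lambda$ is sought as a linear combination of basis polynomials, each erasure gives one linear equation for the coefficients. Let $\alpha_1,\alpha_2,\dots$ be the elements $\alpha^{-p}$ for the positions $p$ in the order in which they are erased. Only the task of finding the list of solutions is considered here, not the choice of one solution from the list. Extended Euclidean algorithm (EEA): $r^{(-1)}(x)=x^{d-1}$, $r^{(0)}(x)=S(x)$, $u^{(-1)}(x)=0$, $u^{(0)}(x)=1$, and recursively $r^{(j+1)}=r^{(j-1)}-q^{(j+1)}r^{(j)}$ with $\deg r^{(j+1)}<\deg r^{(j)}$, and $u^{(j+1)}=u^{(j-1)}-q^{(j+1)}u^{(j)}$. Put $s^{(j)}=\deg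 u^{(j)}-1$; the coefficients of $r^{(j)}$ of degree at most $s^{(j)}$ are regarded as unknown. Put $c^{(j+1)}=\deg r^{(j)}-s^{(j)}$, the maximal number of coefficients of $q^{(j+1)}$ that can be calculated. Index $i_B$: it is such that $\deg u^{(i_B)}\le\left\lfloor\frac{d-1}{2}\right\rfloor$ and $\deg u^{(i_B+1)}>\left\lfloor\frac{d-1}{2}\right\rfloor$. Here, if $c^{(i_B+1)}<0$, one sets $\deg q^{(i_B+1)}=\deg r^{(i_B-1)}-\max\{\deg r^{(i_B)},s^{(i_B)}\}$ and correspondingly $\deg u^{(i_B+1)}=\deg u^{(i_B)}+\deg q^{(i_B+1)}$. Basis polynomials: $\Delta^{(1)}=u^{(i_B)}$. If $c^{(i_B+1)}\le 0$, then $\Delta^{(2)}=u^{(i_B-1)}$. If $0<c^{(i_B+1)}<\deg r^{(i_B-1)}-\deg r^{(i_B)}$, let $\hat q^{(i_B+1)}$ be the part of $q^{(i_B+1)}$ with known coefficients (the $c^{(i_B+1)}$ highest-order ones), and $\Delta^{(2)}=u^{(i_B-1)}-\hat q^{(i_B+1)}u^{(i_B)}$. Integer $t_1$: defined by $\deg u^{(i_B+1)}=\left\lfloor\frac{d-1}{2}\right\rfloor+t_1$. Matrix $\mathbf{A}$: the entry in row $m$ is the value at $x=\alpha_m$ of the polynomial belonging to the column. For $t_1=1$ the columns belong to $\Delta^{(1)},\,x\Delta^{(1)},\,\Delta^{(2)},\,x^2\Delta^{(1)},\,x\Delta^{(2)},\dots$. For general $t_1$ the first $2t_1$ columns belong to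 $\Delta^{(1)},x\Delta^{(1)},\dots,x^{2t_1-1}\Delta^{(1)}$, column $2t_1+1$ belongs to $\Delta^{(2)}$, and afterwards the further multiples $x^{2t_1}\Delta^{(1)},x\Delta^{(2)},x^{2t_1+1}\Delta^{(1)},x^2\Delta^{(2)},\dots$ alternate. A vector represents the linear combination of the column polynomials with its entries as coefficients. FIA (Feng and Tzeng): it solves homogeneous linear systems. In its original version it gives the smallest set of linearly dependent leading columns of a matrix together with the connection vector indicating the vanishing linear combination. It starts the examination of each column with a connection vector, called the starting vector, and calculates in each row a discrepancy (the value of the linear combination, given by the connection vector, of the entries of that row). If the discrepancy is zero, the connection vector is a valid solution for the current subsystem of equations and the algorithm proceeds with the next row. If it is nonzero, the connection vector is updated if possible (by means of a previously stored vector); otherwise the vector and the discrepancy are stored. The basic FIA has complexity $\mathcal{O}(d^3)$. *)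

theory Defs
  imports "HOL-Computational_Algebra.Polynomial" "HOL-Library.Monad_Syntax"
begin

section \<open>Reed-Solomon codes and the syndrome\<close>

definition has_order :: "'a::field \<Rightarrow> nat \<Rightarrow> bool" where
  "has_order \<alpha> n \<longleftrightarrow> 0 < n \<and> \<alpha> ^ n = 1 \<and> (\<forall>m. 0 < m \<and> m < n \<longrightarrow> \<alpha> ^ m \<noteq> 1)"

definition rs_code :: "'a::field \<Rightarrow> nat \<Rightarrow> nat \<Rightarrow> 'a poly set" where
  "rs_code \<alpha> n d = {c. degree c < n \<and> (\<forall>j < d - 1. poly c (\<alpha> ^ j) = 0)}"

definition spectrum :: "'a::field \<Rightarrow> nat \<Rightarrow> 'a poly \<Rightarrow> 'a poly" where
  "spectrum \<alpha> n w = (\<Sum>j<n. monom (poly w (\<alpha> ^ j)) j)"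

definition syndrome :: "'a::field \<Rightarrow> nat \<Rightarrow> nat \<Rightarrow> 'a poly \<Rightarrow> 'a poly" where
  "syndrome \<alpha> n d w = spectrum \<alpha> n w mod monom 1 (d - 1)"

definition locators :: "'a::field \<Rightarrow> nat list \<Rightarrow> 'a list" where
  "locators \<alpha> ps = map (\<lambda>p. inverse \<alpha> ^ p) ps"


section \<open>Extended Euclidean algorithm and basis polynomials\<close>

text \<open>
  The sequences of the paper start at index $-1$; here all indices of r and u are shifted by one:
  \<^term>\<open>eea_r d S (Suc j)\<close> is $r^{(j)}$ and \<^term>\<open>eea_u d S (Suc j)\<close> is $u^{(j)}$, while
  \<^term>\<open>eea_q d S j\<close> is $q^{(j+1)}$. Values after the first zero remainder are meaningless and are
  never used.
\<close>

fun eea_r :: "nat \<Rightarrow> 'a::field poly \<Rightarrow> nat \<Rightarrow> 'a poly" where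
  "eea_r d S 0 = monom 1 (d - 1)"
| "eea_r d S (Suc 0) = S"
| "eea_r d S (Suc (Suc j)) = eea_r d S j mod eea_r d S (Suc j)"

definition eea_q :: "nat \<Rightarrow> 'a::field poly \<Rightarrow> nat \<Rightarrow> 'a poly" where
  "eea_q d S j = eea_r d S j div eea_r d S (Suc j)"

fun eea_u :: "nat \<Rightarrow> 'a::field poly \<Rightarrow> nat \<Rightarrow> 'a poly" where
  "eea_u d S 0 = 0"
| "eea_u d S (Suc 0) = 1"
| "eea_u d S (Suc (Suc j)) = eea_u d S j - eea_q d S j * eea_u d S (Suc j)"

definition eea_s :: "nat \<Rightarrow> 'a::field poly \<Rightarrow> nat \<Rightarrow> int" where
  "eea_s d S j = int (degree (eea_u d S (Suc j))) - 1"

text \<open>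
  \<^term>\<open>eea_c d S j\<close> is $c^{(j+1)}$. The paper's degree of the zero polynomial is $-\infty$, so that
  $c^{(j+1)} = -\infty$ if $r^{(j)} = 0$; only the sign matters then, and $-1$ stands for it.
\<close>

definition eea_c :: "nat \<Rightarrow> 'a::field poly \<Rightarrow> nat \<Rightarrow> int" where
  "eea_c d S j =
     (if eea_r d S (Suc j) = 0 then -1 else int (degree (eea_r d S (Suc j))) - eea_s d S j)"

text \<open>
  The degree of $u^{(j+1)}$, with the convention for negative $c^{(j+1)}$.
\<close>

definition next_deg :: "nat \<Rightarrow> 'a::field poly \<Rightarrow> nat \<Rightarrow> int" where
  "next_deg d S j =
     (if eea_c d S j < 0
      then int (degree (eea_u d S (Suc j))) +
           (int (degree (eea_r d S j)) -
              (if eea_r d S (Suc j) = 0 then eea_s d S j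
               else max (int (degree (eea_r d S (Suc j)))) (eea_s d S j)))
      else int (degree (eea_u d S (Suc (Suc j)))))"

definition i_B :: "nat \<Rightarrow> 'a::field poly \<Rightarrow> nat" where
  "i_B d S = (LEAST i. degree (eea_u d S (Suc i)) \<le> (d - 1) div 2 \<and>
                       next_deg d S i > int ((d - 1) div 2))"

definition t_1 :: "nat \<Rightarrow> 'a::field poly \<Rightarrow> nat" where
  "t_1 d S = nat (next_deg d S (i_B d S) - int ((d - 1) div 2))"

text \<open>
  The part of a polynomial formed by its k coefficients of highest order.
\<close>

definition high_part :: "nat \<Rightarrow> 'a::field poly \<Rightarrow> 'a poly" where
  "high_part k q = q - poly_cutoff (degree q + 1 - k) q"

definition Delta1 :: "nat \<Rightarrow> 'a::field poly \<Rightarrow> 'a poly" where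
  "Delta1 d S = eea_u d S (Suc (i_B d S))"

text \<open>
  If $c^{(i_B+1)} > 0$, then $c^{(i_B+1)}$ is at most the degree of $q^{(i_B+1)}$; equality is
  possible for even d with $t_1 = 1$, and the same formula is used in that boundary case.
\<close>

definition Delta2 :: "nat \<Rightarrow> 'a::field poly \<Rightarrow> 'a poly" where
  "Delta2 d S =
     (let i = i_B d S; c = eea_c d S i in
      if c \<le> 0 then eea_u d S i
      else eea_u d S i - high_part (nat c) (eea_q d S i) * eea_u d S (Suc i))"


section \<open>The matrix of evaluations\<close>

text \<open>
  Rows and columns are numbered from 1. A vector is a list, whose entry number l (counted from 0)
  belongs to column l + 1.
\<close>

definition col_poly :: "nat \<Rightarrow> 'a::field poly \<Rightarrow> 'a poly \<Rightarrow> nat \<Rightarrow> 'a poly" where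
  "col_poly t1 D1 D2 i =
     (if i \<le> 2 * t1 then monom 1 (i - 1) * D1
      else if odd i then monom 1 ((i - (2 * t1 + 1)) div 2) * D2
      else monom 1 (2 * t1 + (i - (2 * t1 + 2)) div 2) * D1)"

definition represents :: "nat \<Rightarrow> 'a::field poly \<Rightarrow> 'a poly \<Rightarrow> 'a list \<Rightarrow> 'a poly" where
  "represents t1 D1 D2 v = (\<Sum>l<length v. smult (v ! l) (col_poly t1 D1 D2 (Suc l)))"

definition eval_matrix ::
    "nat \<Rightarrow> 'a::field poly \<Rightarrow> 'a poly \<Rightarrow> 'a list \<Rightarrow> nat \<Rightarrow> nat \<Rightarrow> 'a" where
  "eval_matrix t1 D1 D2 xs m i = poly (col_poly t1 D1 D2 i) (xs ! (m - 1))"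

definition solves :: "(nat \<Rightarrow> nat \<Rightarrow> 'a::field) \<Rightarrow> nat \<Rightarrow> 'a list \<Rightarrow> bool" where
  "solves A j v \<longleftrightarrow> (\<forall>m\<in>{1..j}. (\<Sum>l<length v. A m (Suc l) * v ! l) = 0)"

definition subsystem_solutions :: "(nat \<Rightarrow> nat \<Rightarrow> 'a::field) \<Rightarrow> nat \<Rightarrow> 'a list set" where
  "subsystem_solutions A \<tau> = {v. length v = 2 * \<tau> + 1 \<and> solves A (2 * \<tau>) v}"

text \<open>
  The vectors of length L that are linear combinations of the given vectors, shorter ones being
  extended by zeros at the end.
\<close>

definition lin_span :: "nat \<Rightarrow> 'a::field list list \<Rightarrow> 'a list set" where
  "lin_span L ws = {v. length v = L \<and>
     (\<exists>b. \<forall>l<L. v ! l = (\<Sum>h<length ws. b h * nth_default 0 (ws ! h) l))}"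

definition candidate_locators ::
    "nat \<Rightarrow> 'a::field poly \<Rightarrow> 'a poly \<Rightarrow> 'a list \<Rightarrow> nat \<Rightarrow> 'a poly set" where
  "candidate_locators t1 D1 D2 xs \<tau> =
     {L. (\<exists>v. length v = 2 * \<tau> + 1 \<and> L = represents t1 D1 D2 v) \<and>
         (\<forall>m\<in>{1..2 * \<tau>}. poly L (xs ! (m - 1)) = 0)}"


section \<open>Computations with a count of elementary steps\<close>

text \<open>
  Elementary steps are field operations and zero tests, and reading or writing one memory cell.
  Functions on \<^typ>\<open>nat\<close> and the lists that hold the rows of a matrix model arrays, with unit-cost
  access.
\<close>

datatype 'b tm = TM (val: 'b) (time: nat)

definition bind_tm :: "'b tm \<Rightarrow> ('b \<Rightarrow> 'c tm) \<Rightarrow> 'c tm" where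
  "bind_tm p f = TM (val (f (val p))) (time p + time (f (val p)))"

adhoc_overloading Monad_Syntax.bind \<rightleftharpoons> bind_tm

definition tick :: "nat \<Rightarrow> 'b tm \<Rightarrow> 'b tm" where
  "tick k p = TM (val p) (k + time p)"


section \<open>The fundamental iterative algorithm\<close>

text \<open>
  \<open>row_store\<close> maps a row to the connection vector and the discrepancy stored for it;
  \<open>col_store\<close> maps a column to its final connection vector and the row for which this vector was
  stored, which is N + 1 if the vector satisfies all N rows. \<open>trace\<close> is not used by the algorithm:
  it lists, in order, the pairs (row, column) for which a discrepancy was calculated.
\<close>

record 'a fia_state =
  row_store :: "nat \<Rightarrow> ('a list \<times> 'a) option"
  col_store :: "nat \<Rightarrow> 'a list \<times> nat"
  trace :: "(nat \<times> nat) list"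

definition fia_init :: "'a fia_state" where
  "fia_init = \<lparr>row_store = (\<lambda>_. None), col_store = (\<lambda>_. ([], 0)), trace = []\<rparr>"

fun discrepancy :: "(nat \<Rightarrow> 'a::field) \<Rightarrow> nat \<Rightarrow> 'a list \<Rightarrow> 'a tm" where
  "discrepancy row l [] = TM 0 1"
| "discrepancy row l (x # xs) =
     do { s \<leftarrow> discrepancy row (Suc l) xs; TM (row l * x + s) 3 }"

text \<open>
  The vector v - f w, for w not longer than v.
\<close>

fun update :: "'a::field \<Rightarrow> 'a list \<Rightarrow> 'a list \<Rightarrow> 'a list tm" where
  "update f v [] = TM v 1"
| "update f [] (y # ys) = TM [] 1"
| "update f (x # xs) (y # ys) =
     do { zs \<leftarrow> update f xs ys; TM ((x - f * y) # zs) 3 }"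

text \<open>
  Examination of column i with connection vector v in the given list of remaining rows.
\<close>

fun examine :: "(nat \<Rightarrow> nat \<Rightarrow> 'a::field) \<Rightarrow> nat \<Rightarrow> nat \<Rightarrow> nat list \<Rightarrow> 'a list \<Rightarrow> 'a fia_state \<Rightarrow>
    'a fia_state tm" where
  "examine A N i [] v st =
     TM (st\<lparr>col_store := (col_store st)(i := (v, N + 1))\<rparr>) (length v + 1)"
| "examine A N i (m # ms) v st =
     do { \<delta> \<leftarrow> discrepancy (A m) 1 v;
          let st' = st\<lparr>trace := trace st @ [(m, i)]\<rparr>;
          if \<delta> = 0 then tick 1 (examine A N i ms v st')
          else (case row_store st m of
              Some (w, \<delta>') \<Rightarrow>
                do { v' \<leftarrow> update (\<delta> / \<delta>') v w; tick 3 (examine A N i ms v' st') }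
            | None \<Rightarrow>
                TM (st'\<lparr>row_store := (row_store st)(m := Some (v, \<delta>)),
                        col_store := (col_store st)(i := (v, m))\<rparr>) (length v + 3)) }"

text \<open>
  The algorithm on the first k columns. The parameter \<open>start\<close> yields the starting vector of a
  column and the row in which its examination starts.
\<close>

fun fia :: "('a::field fia_state \<Rightarrow> nat \<Rightarrow> ('a list \<times> nat) tm) \<Rightarrow> (nat \<Rightarrow> nat \<Rightarrow> 'a) \<Rightarrow> nat \<Rightarrow> nat \<Rightarrow>
    'a fia_state tm" where
  "fia start A N 0 = TM fia_init (N + 1)"
| "fia start A N (Suc k) =
     do { st \<leftarrow> fia start A N k;
          (v, j) \<leftarrow> start st (Suc k);
          examine A N (Suc k) [j..<N + 1] v st }"

definition basic_start :: "'a::field fia_state \<Rightarrow> nat \<Rightarrow> ('a list \<times> nat) tm" where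
  "basic_start st i = TM (replicate (i - 1) 0 @ [1], 1) i"

definition pad :: "nat \<Rightarrow> 'a::field list \<Rightarrow> 'a list" where
  "pad t1 v = 0 # take (2 * t1 - 1) v @ 0 # drop (2 * t1 - 1) v"

definition modified_start :: "nat \<Rightarrow> 'a::field fia_state \<Rightarrow> nat \<Rightarrow> ('a list \<times> nat) tm" where
  "modified_start t1 st i =
     (if i = 1 \<or> i = 2 * t1 + 1 then basic_start st i
      else if i \<le> 2 * t1 then (case col_store st (i - 1) of (v, j) \<Rightarrow> TM (0 # v, j) i)
      else (case col_store st (i - 2) of (v, j) \<Rightarrow> TM (pad t1 v, j) i))"

text \<open>
  A vector stored for row j satisfies the first j - 1 equations, so column i contributes to the
  solutions of the upper left subsystem with 2 \<open>\<tau>\<close> rows if its vector was stored for a later row.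
\<close>

definition fia_solutions :: "'a fia_state \<Rightarrow> nat \<Rightarrow> 'a list list" where
  "fia_solutions st \<tau> =
     map (\<lambda>i. fst (col_store st i)) (filter (\<lambda>i. snd (col_store st i) > 2 * \<tau>) [1..<2 * \<tau> + 2])"

definition finds_all_solutions ::
    "(nat \<Rightarrow> nat \<Rightarrow> 'a::field) \<Rightarrow> nat \<Rightarrow> 'a fia_state \<Rightarrow> bool" where
  "finds_all_solutions A T st \<longleftrightarrow>
     (\<forall>\<tau>\<le>T. fia_solutions st \<tau> \<noteq> [] \<and>
        (\<forall>v\<in>set (fia_solutions st \<tau>). v \<noteq> [] \<and> last v \<noteq> 0) \<and>
        subsystem_solutions A \<tau> = lin_span (2 * \<tau> + 1) (fia_solutions st \<tau>))"

text \<open>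
  The examined positions can be arranged, by distributing the columns over k classes, into k passes
  through the matrix, each of which only moves from top to bottom.
\<close>

definition traversals :: "nat \<Rightarrow> (nat \<times> nat) list \<Rightarrow> bool" where
  "traversals k tr \<longleftrightarrow>
     (\<exists>f. \<forall>i. f i < k \<and> sorted (map fst (filter (\<lambda>(m, i'). f i' = f i) tr)))"


section \<open>From the syndrome to the list of solutions\<close>

text \<open>
  The costs charged for operations on polynomials are those of schoolbook division with remainder
  and of schoolbook multiplication followed by a subtraction.
\<close>

definition div_cost :: "'a::field poly \<Rightarrow> 'a poly \<Rightarrow> nat" where
  "div_cost p r = (degree p + 1) + (degree p + 1 - degree r) * (2 * degree r + 3)"

definition mult_sub_cost :: "'a::field poly \<Rightarrow> 'a poly \<Rightarrow> 'a poly \<Rightarrow> nat" where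
  "mult_sub_cost a q u = (degree a + 1) + 2 * (degree q + 1) * (degree u + 1)"

text \<open>
  The loop runs as long as the next polynomial u has degree at most b. It uses that the degree of the
  next u is the sum of the degrees of the present u and of the next quotient.
\<close>

function eea_loop :: "nat \<Rightarrow> 'a::field poly \<Rightarrow> 'a poly \<Rightarrow> 'a poly \<Rightarrow> 'a poly \<Rightarrow>
    ('a poly \<times> 'a poly \<times> 'a poly \<times> 'a poly) tm" where
  "eea_loop b r' r u' u =
     (if r = 0 \<or> degree u + (degree r' - degree r) > b then TM (r', r, u', u) 1
      else tick (div_cost r' r + mult_sub_cost u' (r' div r) u)
             (eea_loop b r (r' mod r) u (u' - (r' div r) * u)))"
  by pat_completeness auto
termination
  by (relation "measure (\<lambda>(b, r', r, u', u). if r = 0 then 0 else Suc (degree r))")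
    (auto dest: degree_mod_less')

definition basis_tm :: "nat \<Rightarrow> 'a::field poly \<Rightarrow> (nat \<times> 'a poly \<times> 'a poly) tm" where
  "basis_tm d S =
     do { let b = (d - 1) div 2;
          (r', r, u', u) \<leftarrow> eea_loop b (monom 1 (d - 1)) S 0 1;
          let c = (if r = 0 then -1 else int (degree r) - (int (degree u) - 1));
          let t1 = nat (int (degree r') - int b +
                     (if c < 0 then 1 else int (degree u) - int (degree r)));
          if c \<le> 0 then TM (t1, u, u') 1
          else (let q = high_part (nat c) (r' div r) in
                TM (t1, u, u' - q * u) (div_cost r' r + mult_sub_cost u' q u)) }"

fun horner :: "'a::field \<Rightarrow> 'a list \<Rightarrow> 'a tm" where
  "horner x [] = TM 0 1"
| "horner x (c # cs) = do { s \<leftarrow> horner x cs; TM (c + x * s) 3 }"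

text \<open>
  The first k entries of a row; each one is obtained from an earlier entry by one multiplication.
\<close>

fun row_tm :: "nat \<Rightarrow> 'a::field \<Rightarrow> 'a \<Rightarrow> 'a \<Rightarrow> nat \<Rightarrow> (nat \<Rightarrow> 'a) tm" where
  "row_tm t1 y1 y2 x 0 = TM (\<lambda>_. 0) 1"
| "row_tm t1 y1 y2 x (Suc k) =
     do { row \<leftarrow> row_tm t1 y1 y2 x k;
          TM (row(Suc k :=
                (if k = 0 then y1
                 else if k = 2 * t1 then y2
                 else if k < 2 * t1 then x * row k
                 else x * row (k - 1)))) 3 }"

fun matrix_tm :: "nat \<Rightarrow> 'a::field poly \<Rightarrow> 'a poly \<Rightarrow> nat \<Rightarrow> 'a list \<Rightarrow> (nat \<Rightarrow> 'a) list tm" where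
  "matrix_tm t1 D1 D2 k [] = TM [] 1"
| "matrix_tm t1 D1 D2 k (x # xs) =
     do { y1 \<leftarrow> horner x (coeffs D1);
          y2 \<leftarrow> horner x (coeffs D2);
          row \<leftarrow> row_tm t1 y1 y2 x k;
          rows \<leftarrow> matrix_tm t1 D1 D2 k xs;
          TM (row # rows) 1 }"

text \<open>
  For each \<open>\<tau>\<close>, listing the solutions takes one comparison and at most one reference per column.
\<close>

definition collect_tm :: "nat \<Rightarrow> 'a fia_state \<Rightarrow> 'a list list list tm" where
  "collect_tm T st = TM (map (fia_solutions st) [0..<T + 1]) (\<Sum>\<tau>\<le>T. 2 * (2 * \<tau> + 1))"

definition gmd_tm :: "nat \<Rightarrow> 'a::field poly \<Rightarrow> 'a list \<Rightarrow> nat \<Rightarrow> 'a list list list tm" where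
  "gmd_tm d S xs T =
     do { (t1, D1, D2) \<leftarrow> basis_tm d S;
          rows \<leftarrow> matrix_tm t1 D1 D2 (2 * T + 1) (take (2 * T) xs);
          st \<leftarrow> fia (modified_start t1) (\<lambda>m i. (rows ! (m - 1)) i) (2 * T) (2 * T + 1);
          collect_tm T st }"

end

theory Submission
  imports Defs
begin

text \<open>
  Whatever the starting vectors are, provided that the one of column i has length i, a nonzero last
  entry, and solves the equations above the row where the examination starts, the vectors stored by
  the FIA are triangular and distinct columns are stored for distinct rows. Hence the vectors stored
  for rows beyond M span the solutions of the first M equations: in an expansion of a solution over
  all stored vectors, the least row in which one of the participating vectors fails would show a
  nonzero discrepancy. Padding multiplies the represented polynomial by x, which preserves its zeros,
  so the modified starting vectors are admissible.

  For the complexity, the columns are split into classes such that within a class each examination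
  starts no higher than the previous ones stopped. All the examinations of a class together then
  descend at most once through the rows, whence c classes cost c traversals. The modified starting
  vectors need only two classes: columns up to \<open>2 t\<^sub>1\<close> together with the even ones, and the remaining
  odd columns.
\<close>

section \<open>Vectors and discrepancies\<close>

definition disc :: "(nat \<Rightarrow> nat \<Rightarrow> 'a::field) \<Rightarrow> nat \<Rightarrow> 'a list \<Rightarrow> 'a" where
  "disc A m v = (\<Sum>l<length v. A m (Suc l) * v ! l)"

lemma solves_disc: "solves A j v \<longleftrightarrow> (\<forall>m\<in>{1..j}. disc A m v = 0)"
  by (simp add: solves_def disc_def)

text \<open>Zeros appended at the end do not change the value, so vectors of different lengths can
  be compared over one common range of columns.\<close>

lemma disc_nth_default:
  assumes "length v \<le> L"
  shows "disc A m v = (\<Sum>l<L. A m (Suc l) * nth_default 0 v l)"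
  unfolding disc_def using assms
  by (intro sum.mono_neutral_cong_left) (auto simp: nth_default_def)

section \<open>Values and costs of the two vector operations\<close>

lemma val_discrepancy:
  "val (discrepancy row (Suc l) v) = (\<Sum>h<length v. row (Suc (l + h)) * v ! h)"
proof (induction v arbitrary: l)
  case (Cons x v)
  show ?case
    by (simp add: bind_tm_def Cons sum.lessThan_Suc_shift del: sum.lessThan_Suc)
qed simp

lemma val_discrepancy_disc [simp]: "val (discrepancy (A m) (Suc 0) v) = disc A m v"
  by (simp add: val_discrepancy disc_def)

lemma time_discrepancy [simp]: "time (discrepancy row l v) = 3 * length v + 1"
  by (induction v arbitrary: l) (auto simp: bind_tm_def)

lemma discrepancy_cong:
  assumes "\<And>h. h < length v \<Longrightarrow> row (l + h) = row' (l + h)"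
  shows "discrepancy row l v = discrepancy row' l v"
  using assms
proof (induction v arbitrary: l)
  case (Cons x v)
  have "discrepancy row (Suc l) v = discrepancy row' (Suc l) v"
    by (rule Cons.IH) (use Cons.prems[of "Suc _"] in simp)
  with Cons.prems[of 0] show ?case by simp
qed simp

lemma length_update [simp]: "length (val (update f v w)) = length v"
  by (induction f v w rule: update.induct) (auto simp: bind_tm_def)

lemma time_update: "time (update f v w) \<le> 3 * length v + 1"
  by (induction f v w rule: update.induct) (auto simp: bind_tm_def)

lemma nth_default_update:
  "length w \<le> length v \<Longrightarrow>
     nth_default 0 (val (update f v w)) l = nth_default 0 v l - f * nth_default 0 w l"
  by (induction f v w arbitrary: l rule: update.induct)
    (auto simp: bind_tm_def nth_default_Cons split: nat.splits)

text \<open>A strictly shorter w does not reach the last entry of v. With stored vectors of earlier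
  columns as w, the leading entry of a column's vector therefore survives every update.\<close>

lemma last_update: "length w < length v \<Longrightarrow> last (val (update f v w)) = last v"
proof (induction f v w rule: update.induct)
  case (3 f x xs y ys)
  then have "xs \<noteq> []" "val (update f xs ys) \<noteq> []"
    by (auto simp flip: length_0_conv)
  with 3 show ?case by (auto simp: bind_tm_def)
qed auto

lemma disc_update:
  assumes "length w \<le> length v"
  shows "disc A m (val (update f v w)) = disc A m v - f * disc A m w"
  using assms
  by (simp add: disc_nth_default[of _ "length v"] nth_default_update right_diff_distrib
      sum_subtractf sum_distrib_left mult.left_commute)

section \<open>The invariant of the FIA\<close>

text \<open>A column whose vector satisfies all rows is marked by j = N + 1 and occupies no row. The
  two conjuncts together make \<open>row_store\<close> and \<open>col_store\<close> inverse to each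
  other on the occupied rows; by the second one, a stored vector comes from an earlier column and is
  shorter than the vector to be updated.\<close>

definition fia_inv :: "(nat \<Rightarrow> nat \<Rightarrow> 'a::field) \<Rightarrow> nat \<Rightarrow> nat \<Rightarrow> 'a fia_state \<Rightarrow> bool" where
  "fia_inv A N k st \<longleftrightarrow>
     (\<forall>i\<in>{1..k}. \<forall>v j. col_store st i = (v, j) \<longrightarrow>
        length v = i \<and> last v \<noteq> 0 \<and> 1 \<le> j \<and> j \<le> N + 1 \<and> solves A (j - 1) v \<and>
        (j \<le> N \<longrightarrow> disc A j v \<noteq> 0 \<and> row_store st j = Some (v, disc A j v))) \<and>
     (\<forall>m w \<delta>. row_store st m = Some (w, \<delta>) \<longrightarrow> 1 \<le> m \<and> m \<le> N \<and>
        (\<exists>i\<in>{1..k}. col_store st i = (w, m)))"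

lemma fia_inv_colD:
  assumes "fia_inv A N k st" "i \<in> {1..k}" "col_store st i = (v, j)"
  shows "length v = i" "last v \<noteq> 0" "1 \<le> j" "j \<le> N + 1" "solves A (j - 1) v"
    "j \<le> N \<Longrightarrow> disc A j v \<noteq> 0" "j \<le> N \<Longrightarrow> row_store st j = Some (v, disc A j v)"
  using assms unfolding fia_inv_def by blast+

lemma fia_inv_rowD:
  assumes "fia_inv A N k st" "row_store st m = Some (w, \<delta>)"
  shows "1 \<le> m" "m \<le> N" "length w \<le> k" "solves A (m - 1) w" "\<delta> = disc A m w" "\<delta> \<noteq> 0"
proof -
  from assms obtain i where i: "i \<in> {1..k}" "col_store st i = (w, m)" and m: "1 \<le> m" "m \<le> N"
    unfolding fia_inv_def by blast
  note col = fia_inv_colD[OF assms(1) i]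
  show "1 \<le> m" "m \<le> N" by fact+
  show "length w \<le> k" using col(1) i(1) by simp
  show "solves A (m - 1) w" by (rule col(5))
  show "\<delta> = disc A m w" "\<delta> \<noteq> 0" using col(6,7)[OF m(2)] assms(2) by simp_all
qed

text \<open>A row holds only one vector, and the length of this vector is the number of its column.
  Only the mark N + 1 can be shared.\<close>

lemma fia_inv_stored_inj:
  assumes inv: "fia_inv A N k st" and "i \<in> {1..k}" "i' \<in> {1..k}"
    and eq: "snd (col_store st i) = snd (col_store st i')" and le: "snd (col_store st i) \<le> N"
  shows "i = i'"
proof -
  obtain v j v' j' where c: "col_store st i = (v, j)" "col_store st i' = (v', j')"
    by (meson surj_pair)
  have "row_store st j = Some (v, disc A j v)"
    by (rule fia_inv_colD(7)[OF inv assms(2) c(1)]) (use le c in simp)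
  moreover have "row_store st j' = Some (v', disc A j' v')"
    by (rule fia_inv_colD(7)[OF inv assms(3) c(2)]) (use le eq c in simp)
  ultimately have "v = v'" using eq c by simp
  then show ?thesis
    using fia_inv_colD(1)[OF inv assms(2) c(1)] fia_inv_colD(1)[OF inv assms(3) c(2)] by simp
qed

lemma fia_inv_init: "fia_inv A N 0 fia_init"
  by (simp add: fia_inv_def fia_init_def)

lemma fia_inv_trace [simp]: "fia_inv A N k (st\<lparr>trace := tr\<rparr>) \<longleftrightarrow> fia_inv A N k st"
  by (simp add: fia_inv_def)

lemma bex_fun_upd_Suc:
  assumes "\<exists>i\<in>{1..k}. g i = x"
  shows "\<exists>i\<in>{1..Suc k}. (g(Suc k := y)) i = x"
proof -
  from assms obtain i where "i \<in> {1..k}" "g i = x" by blast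
  then show ?thesis by (intro bexI[of _ i]) auto
qed

text \<open>Both ways in which an examination ends are treated at once: for m \<le> N the vector is
  put into the free row m, for m = N + 1 it has passed all rows and only the column is
  recorded.\<close>

lemma fia_inv_store:
  assumes inv: "fia_inv A N k st" and v: "length v = Suc k" "last v \<noteq> 0" "solves A (m - 1) v"
    and m: "1 \<le> m" "m \<le> N + 1"
    and free: "m \<le> N \<Longrightarrow> disc A m v \<noteq> 0 \<and> row_store st m = None"
    and row: "row_store st' = (row_store st)(m := if m \<le> N then Some (v, disc A m v) else None)"
    and col: "col_store st' = (col_store st)(Suc k := (v, m))"
  shows "fia_inv A N (Suc k) st'"
proof -
  \<comment> \<open>If m \<le> N, row m was free, hence no earlier column is recorded for it and the
    new entry destroys nothing.\<close>
  have old: "j \<noteq> m" if "i \<in> {1..k}" "col_store st i = (w, j)" "j \<le> N" for i w j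
    using fia_inv_colD(7)[OF inv that] free that(3) by auto
  have "length w = i \<and> last w \<noteq> 0 \<and> 1 \<le> j \<and> j \<le> N + 1 \<and> solves A (j - 1) w \<and>
      (j \<le> N \<longrightarrow> disc A j w \<noteq> 0 \<and> row_store st' j = Some (w, disc A j w))"
    if "i \<in> {1..Suc k}" "col_store st' i = (w, j)" for i w j
  proof (cases "i = Suc k")
    case True
    then have "w = v" "j = m" using that col by simp_all
    with v m free row True show ?thesis by simp
  next
    case False
    then have i: "i \<in> {1..k}" "col_store st i = (w, j)" using that col by simp_all
    have "row_store st' j = row_store st j" if "j \<le> N"
      using old[OF i that] row by simp
    with fia_inv_colD[OF inv i] show ?thesis by simp
  qed
  moreover have "1 \<le> m' \<and> m' \<le> N \<and> (\<exists>i\<in>{1..Suc k}. col_store st' i = (w, m'))"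
    if "row_store st' m' = Some (w, \<delta>)" for m' w \<delta>
  proof (cases "m' = m")
    case True
    then have "m \<le> N" "w = v" using that row by (simp_all split: if_splits)
    then show ?thesis using True m col by (intro conjI bexI[of _ "Suc k"]) simp_all
  next
    case False
    then have old_row: "row_store st m' = Some (w, \<delta>)" using that row by simp
    then have "\<exists>i\<in>{1..k}. col_store st i = (w, m')"
      using inv unfolding fia_inv_def by blast
    then have "\<exists>i\<in>{1..Suc k}. col_store st' i = (w, m')"
      unfolding col by (rule bex_fun_upd_Suc)
    with fia_inv_rowD(1,2)[OF inv old_row] show ?thesis by blast
  qed
  ultimately show ?thesis unfolding fia_inv_def by blast
qed

text \<open>Induction on the number of remaining rows, with varying vector and state. With i = k +
  1, a row that is passed costs at most 3 i + 1 for the discrepancy, 3 i + 1 for the update and 3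
  for bookkeeping; ending the examination costs at most 4 i + 4. The minimum in the trace is there
  because the stopping row is itself examined unless it is the fictitious row N + 1.\<close>

lemma examine_correct:
  assumes "fia_inv A N k st" "length v = Suc k" "last v \<noteq> 0" "1 \<le> j" "j \<le> N + 1"
    "solves A (j - 1) v"
  defines "ex \<equiv> examine A N (Suc k) [j..<N + 1] v st"
  defines "stop \<equiv> snd (col_store (val ex) (Suc k))"
  shows "fia_inv A N (Suc k) (val ex) \<and> j \<le> stop \<and>
     (\<forall>i. i \<noteq> Suc k \<longrightarrow> col_store (val ex) i = col_store st i) \<and>
     trace (val ex) = trace st @ map (\<lambda>m. (m, Suc k)) [j..<min (Suc stop) (N + 1)] \<and>
     time ex \<le> (stop - j) * (6 * Suc k + 5) + 4 * Suc k + 4"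
  using assms(1-6) unfolding ex_def stop_def
proof (induction "N + 1 - j" arbitrary: j v st)
  case 0
  then have j: "j = N + 1" by simp
  \<comment> \<open>For m = N + 1, \<open>fia_inv_store\<close> expects the entry of row N + 1 to be
    cleared; it is empty already.\<close>
  have "row_store st (Suc N) = None"
    using fia_inv_rowD(2)[OF 0(2), of "Suc N"] by (cases "row_store st (Suc N)") auto
  then have "fia_inv A N (Suc k) (st\<lparr>col_store := (col_store st)(Suc k := (v, Suc N))\<rparr>)"
    using 0(2-4,7) j by (intro fia_inv_store[of A N k st v "Suc N"]) (simp_all add: fun_upd_idem)
  with 0(3) j show ?case by simp
next
  case (Suc x)
  have jN: "j \<le> N" using Suc.hyps(2) by simp
  have upt: "[j..<N + 1] = j # [Suc j..<N + 1]" using jN by (simp add: upt_conv_Cons)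
  let ?st = "st\<lparr>trace := trace st @ [(j, Suc k)]\<rparr>"
  let ?goal = "\<lambda>ex st v j. fia_inv A N (Suc k) (val ex) \<and> j \<le> snd (col_store (val ex) (Suc k)) \<and>
     (\<forall>i. i \<noteq> Suc k \<longrightarrow> col_store (val ex) i = col_store st i) \<and>
     trace (val ex) = trace st @
       map (\<lambda>m. (m, Suc k)) [j..<min (Suc (snd (col_store (val ex) (Suc k)))) (N + 1)] \<and>
     time ex \<le> (snd (col_store (val ex) (Suc k)) - j) * (6 * Suc k + 5) + 4 * Suc k + 4"
  \<comment> \<open>Shared by the two cases in which the examination goes on to the next row, with
    the vector unchanged or updated.\<close>
  have step: "?goal ex st v j"
    if IH: "?goal ex' ?st v' (Suc j)" and "val ex = val ex'" "time ex \<le> time ex' + (6 * Suc k + 5)"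
    for ex ex' v'
  proof -
    let ?s = "snd (col_store (val ex') (Suc k))"
    have s: "Suc j \<le> ?s" using IH by simp
    then have "?s - j = Suc (?s - Suc j)" by simp
    then have t: "(?s - j) * (6 * Suc k + 5) = (6 * Suc k + 5) + (?s - Suc j) * (6 * Suc k + 5)"
      by (simp only: mult_Suc)
    have "[j..<min (Suc ?s) (N + 1)] = j # [Suc j..<min (Suc ?s) (N + 1)]"
      using s jN by (simp add: upt_conv_Cons)
    then have tr: "trace st @ map (\<lambda>m. (m, Suc k)) [j..<min (Suc ?s) (N + 1)] =
      trace ?st @ map (\<lambda>m. (m, Suc k)) [Suc j..<min (Suc ?s) (N + 1)]" by simp
    show ?thesis
      unfolding that(2) tr t using IH that(3) by (simp del: upt_Suc)
  qed
  show ?case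
  proof (cases "disc A j v = 0")
    case True
    have "solves A j v"
      unfolding solves_disc
    proof
      fix m assume "m \<in> {1..j}"
      then have "m \<in> {1..j - 1} \<or> m = j" by auto
      then show "disc A m v = 0" using Suc.prems(6) True unfolding solves_disc by blast
    qed
    then have "?goal (examine A N (Suc k) [Suc j..<N + 1] v ?st) ?st v (Suc j)"
      by (intro Suc.hyps(1)) (use Suc.prems(1-4) Suc.hyps(2) jN in simp_all)
    then show ?thesis
      unfolding upt by (rule step) (use True Suc.prems(2) in
          \<open>simp_all add: bind_tm_def tick_def Let_def del: upt_Suc\<close>)
  next
    case nz: False
    show ?thesis
    proof (cases "row_store st j")
      case None
      have "val (examine A N (Suc k) [j..<N + 1] v st) =
        ?st\<lparr>row_store := (row_store ?st)(j := Some (v, disc A j v)),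
           col_store := (col_store ?st)(Suc k := (v, j))\<rparr>"
        unfolding upt using nz None by (simp add: bind_tm_def Let_def del: upt_Suc)
      moreover have "time (examine A N (Suc k) [j..<N + 1] v st) = 4 * Suc k + 4"
        unfolding upt using nz None Suc.prems(2) by (simp add: bind_tm_def Let_def del: upt_Suc)
      moreover have "[j..<Suc j] = [j]" by simp
      ultimately show ?thesis
        using fia_inv_store[OF Suc.prems(1-3,6,4,5)] None nz jN by (simp del: upt_Suc)
    next
      case (Some p)
      obtain w \<delta> where p: "p = (w, \<delta>)" by (cases p)
      note row = fia_inv_rowD[OF Suc.prems(1) Some[unfolded p]]
      let ?v = "val (update (disc A j v / \<delta>) v w)"
      \<comment> \<open>In row j the factor is chosen to cancel the discrepancy; in the rows above,
        v and w both have discrepancy zero.\<close>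
      have "disc A m ?v = 0" if "m \<in> {1..j}" for m
      proof (cases "m = j")
        case True
        then show ?thesis using row Suc.prems(2) by (simp add: disc_update)
      next
        case False
        with that have "m \<in> {1..j - 1}" by auto
        then show ?thesis
          using row Suc.prems(2,6) by (simp add: disc_update solves_disc)
      qed
      then have "solves A j ?v" by (simp add: solves_disc)
      moreover have "last ?v \<noteq> 0" using row(3) Suc.prems(2,3) by (simp add: last_update)
      ultimately have "?goal (examine A N (Suc k) [Suc j..<N + 1] ?v ?st) ?st ?v (Suc j)"
        by (intro Suc.hyps(1)) (use Suc.prems(1-4) Suc.hyps(2) jN in simp_all)
      then show ?thesis
        unfolding upt
      proof (rule step)
        show "val (examine A N (Suc k) (j # [Suc j..<N + 1]) v st) =
          val (examine A N (Suc k) [Suc j..<N + 1] ?v ?st)"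
          using nz Some p by (simp add: bind_tm_def tick_def Let_def del: upt_Suc)
        show "time (examine A N (Suc k) (j # [Suc j..<N + 1]) v st)
          \<le> time (examine A N (Suc k) [Suc j..<N + 1] ?v ?st) + (6 * Suc k + 5)"
          using nz Some p Suc.prems(2) time_update[of "disc A j v / \<delta>" v w]
          by (simp add: bind_tm_def tick_def Let_def del: upt_Suc)
      qed
    qed
  qed
qed

lemma examine_cong:
  assumes "\<And>m l. m \<in> set ms \<Longrightarrow> 1 \<le> l \<Longrightarrow> l \<le> length v \<Longrightarrow> A m l = A' m l"
  shows "examine A N i ms v st = examine A' N i ms v st"
  using assms
proof (induction ms arbitrary: v st)
  case (Cons m ms)
  have d: "discrepancy (A m) (Suc 0) v = discrepancy (A' m) (Suc 0) v"
    by (rule discrepancy_cong) (use Cons.prems in simp)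
  have "disc A m v = disc A' m v"
    using d by (metis val_discrepancy_disc)
  moreover have "examine A N i ms w st = examine A' N i ms w st" if "length w = length v" for w st
    using that by (intro Cons.IH) (use Cons.prems in simp)
  ultimately show ?case using d by (auto simp: bind_tm_def Let_def split: option.split)
qed simp

section \<open>Runs of the FIA with admissible starting vectors\<close>

text \<open>Admissibility is required in every state with the invariant, so that it can be proved
  for a choice of starting vectors without reference to a run.\<close>

definition good_start ::
    "(nat \<Rightarrow> nat \<Rightarrow> 'a::field) \<Rightarrow> nat \<Rightarrow> ('a fia_state \<Rightarrow> nat \<Rightarrow> ('a list \<times> nat) tm) \<Rightarrow> bool" where
  "good_start A N start \<longleftrightarrow>
     (\<forall>k st v j. fia_inv A N k st \<longrightarrow> val (start st (Suc k)) = (v, j) \<longrightarrow>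
        length v = Suc k \<and> last v \<noteq> 0 \<and> 1 \<le> j \<and> j \<le> N + 1 \<and> solves A (j - 1) v)"

definition start_row ::
    "('a::field fia_state \<Rightarrow> nat \<Rightarrow> ('a list \<times> nat) tm) \<Rightarrow> (nat \<Rightarrow> nat \<Rightarrow> 'a) \<Rightarrow> nat \<Rightarrow> nat \<Rightarrow> nat" where
  "start_row start A N i = snd (val (start (val (fia start A N (i - 1))) i))"

definition stop_row ::
    "('a::field fia_state \<Rightarrow> nat \<Rightarrow> ('a list \<times> nat) tm) \<Rightarrow> (nat \<Rightarrow> nat \<Rightarrow> 'a) \<Rightarrow> nat \<Rightarrow> nat \<Rightarrow> nat" where
  "stop_row start A N i = snd (col_store (val (fia start A N i)) i)"

lemma fia_inv_fia:
  assumes "good_start A N start"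
  shows "fia_inv A N k (val (fia start A N k))"
proof (induction k)
  case (Suc k)
  obtain v j where vj: "val (start (val (fia start A N k)) (Suc k)) = (v, j)"
    by (meson surj_pair)
  have "length v = Suc k \<and> last v \<noteq> 0 \<and> 1 \<le> j \<and> j \<le> N + 1 \<and> solves A (j - 1) v"
    using assms Suc vj unfolding good_start_def by blast
  with examine_correct[OF Suc, of v j] show ?case
    by (simp add: bind_tm_def vj del: upt_Suc)
qed (simp add: fia_inv_init)

lemma fia_Suc_correct:
  fixes k :: nat
  assumes good: "good_start A N start"
  defines "st \<equiv> val (fia start A N k)" and "st' \<equiv> val (fia start A N (Suc k))"
    and "j \<equiv> start_row start A N (Suc k)" and "stop \<equiv> stop_row start A N (Suc k)"
  shows "1 \<le> j" and "j \<le> stop" and "stop \<le> N + 1"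
    and "\<And>i. i \<noteq> Suc k \<Longrightarrow> col_store st' i = col_store st i"
    and "trace st' = trace st @ map (\<lambda>m. (m, Suc k)) [j..<min (Suc stop) (N + 1)]"
    and "time (fia start A N (Suc k)) \<le> time (fia start A N k) + time (start st (Suc k)) +
      (stop - j) * (6 * Suc k + 5) + 4 * Suc k + 4"
proof -
  have inv: "fia_inv A N k st" "fia_inv A N (Suc k) st'"
    unfolding st_def st'_def by (rule fia_inv_fia[OF good])+
  obtain v j0 where vj: "val (start st (Suc k)) = (v, j0)"
    by (meson surj_pair)
  have j0: "j0 = j" using vj by (simp add: j_def start_row_def st_def)
  have v: "length v = Suc k \<and> last v \<noteq> 0 \<and> 1 \<le> j \<and> j \<le> N + 1 \<and> solves A (j - 1) v"
    using good inv vj j0 unfolding good_start_def by blast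
  have st': "st' = val (examine A N (Suc k) [j..<N + 1] v st)"
    using vj by (simp add: st'_def bind_tm_def j0 st_def[symmetric] del: upt_Suc)
  have stop: "stop = snd (col_store (val (examine A N (Suc k) [j..<N + 1] v st)) (Suc k))"
    by (simp add: stop_def stop_row_def st'_def[symmetric] st' del: fia.simps)
  have time: "time (fia start A N (Suc k)) = time (fia start A N k) + time (start st (Suc k)) +
    time (examine A N (Suc k) [j..<N + 1] v st)"
    using vj by (simp add: bind_tm_def j0 st_def[symmetric] del: upt_Suc)
  note ex = examine_correct[OF inv(1), of v j, folded stop, folded st']
  show "1 \<le> j" using v by simp
  show "j \<le> stop" "\<And>i. i \<noteq> Suc k \<Longrightarrow> col_store st' i = col_store st i"
    "trace st' = trace st @ map (\<lambda>m. (m, Suc k)) [j..<min (Suc stop) (N + 1)]"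
    using ex v by auto
  show "time (fia start A N (Suc k)) \<le> time (fia start A N k) + time (start st (Suc k)) +
      (stop - j) * (6 * Suc k + 5) + 4 * Suc k + 4"
    using ex v unfolding time by auto
  show "stop \<le> N + 1"
    using fia_inv_colD(4)[OF inv(2), of "Suc k" _ stop] by (simp add: stop st' prod_eq_iff)
qed

lemma start_row_le_stop_row:
  assumes "good_start A N start" "1 \<le> i"
  shows "1 \<le> start_row start A N i" "start_row start A N i \<le> stop_row start A N i"
    "stop_row start A N i \<le> N + 1"
  using fia_Suc_correct(1-3)[OF assms(1), of "i - 1"] assms(2) by simp_all

lemma snd_col_store_fia:
  assumes "good_start A N start" "i \<le> k"
  shows "snd (col_store (val (fia start A N k)) i) = stop_row start A N i"
  using assms(2)
  by (induction k)
    (auto simp: le_Suc_eq stop_row_def fia_Suc_correct(4)[OF assms(1)] simp del: fia.simps)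

text \<open>A run reads only rows 1 to N of the first k columns. This permits replacing
  \<open>eval_matrix\<close> by the finite table that \<open>matrix_tm\<close> computes.\<close>

lemma fia_cong:
  assumes good: "good_start A N start"
    and "\<And>m l. 1 \<le> m \<Longrightarrow> m \<le> N \<Longrightarrow> 1 \<le> l \<Longrightarrow> l \<le> k \<Longrightarrow> A m l = A' m l"
  shows "fia start A N k = fia start A' N k"
  using assms(2)
proof (induction k)
  case (Suc k)
  have IH: "fia start A N k = fia start A' N k" by (rule Suc.IH) (use Suc.prems in simp)
  obtain v j where vj: "val (start (val (fia start A N k)) (Suc k)) = (v, j)"
    by (meson surj_pair)
  have "length v = Suc k \<and> 1 \<le> j"
    using good fia_inv_fia[OF good, of k] vj unfolding good_start_def by blast
  then have "examine A N (Suc k) [j..<N + 1] v st = examine A' N (Suc k) [j..<N + 1] v st" for st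
    by (intro examine_cong Suc.prems) auto
  with vj show ?case by (simp add: IH[symmetric] bind_tm_def del: upt_Suc)
qed simp

section \<open>Traversals and running time by classes of columns\<close>

lemma mem_trace_fia:
  assumes "good_start A N start" "(m, i) \<in> set (trace (val (fia start A N k)))"
  shows "1 \<le> i \<and> i \<le> k \<and> m \<le> stop_row start A N i"
  using assms(2)
proof (induction k)
  case (Suc k)
  then show ?case
    using fia_Suc_correct(5)[OF assms(1), of k] by (auto simp del: fia.simps upt_Suc)
qed (simp add: fia_init_def)

text \<open>All discrepancies of an earlier column lie in rows up to its stopping row, those of a
  later column of the same class in rows from its starting row on. Appending them keeps the rows of
  the class in ascending order.\<close>

lemma traversals_fia:
  assumes good: "good_start A N start"
    and f: "\<And>i. f i < c"
    and cls: "\<And>i i'. 1 \<le> i \<Longrightarrow> i < i' \<Longrightarrow> i' \<le> k \<Longrightarrow> f i = f i' \<Longrightarrow>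
      stop_row start A N i \<le> start_row start A N i'"
  shows "traversals c (trace (val (fia start A N k)))"
proof -
  have "sorted (map fst (filter (\<lambda>(m, i'). f i' = x) (trace (val (fia start A N k)))))" for x
    using cls
  proof (induction k)
    case 0
    then show ?case by (simp add: fia_init_def)
  next
    case (Suc k)
    let ?fil = "filter (\<lambda>(m, i'). f i' = x)"
    let ?old = "trace (val (fia start A N k))"
    have IH: "sorted (map fst (?fil ?old))" by (rule Suc.IH) (use Suc.prems in simp)
    let ?rows = "[start_row start A N (Suc k)..<min (Suc (stop_row start A N (Suc k))) (N + 1)]"
    have new: "?fil (trace (val (fia start A N (Suc k)))) =
      ?fil ?old @ (if f (Suc k) = x then map (\<lambda>m. (m, Suc k)) ?rows else [])"
      unfolding fia_Suc_correct(5)[OF good] by (induction ?rows) (auto simp: filter_map o_def)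
    have "m \<le> m'" if "f (Suc k) = x" "(m, i) \<in> set ?old" "f i = x" "m' \<in> set ?rows" for m i m'
      using mem_trace_fia[OF good that(2)] Suc.prems[of i "Suc k"] that by (auto simp del: upt_Suc)
    then show ?case
      unfolding new using IH by (auto simp: sorted_append o_def simp del: upt_Suc)
  qed
  with f show ?thesis unfolding traversals_def by blast
qed

text \<open>The half-open intervals from p i up to q i within one class are pairwise disjoint
  subsets of {1..N}, so each class contributes at most N. A row in which one column stops and
  another resumes is not counted twice.\<close>

lemma sum_lengths_classes:
  fixes p q f :: "nat \<Rightarrow> nat"
  assumes f: "\<And>i. f i < c"
    and pq: "\<And>i. 1 \<le> i \<Longrightarrow> 1 \<le> p i \<and> q i \<le> N + 1"
    and cls: "\<And>i i'. 1 \<le> i \<Longrightarrow> i < i' \<Longrightarrow> i' \<le> k \<Longrightarrow> f i = f i' \<Longrightarrow> q i \<le> p i'"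
  shows "(\<Sum>i\<in>{1..k}. q i - p i) \<le> c * N"
proof -
  have "(\<Sum>i\<in>{i\<in>{1..k}. f i = y}. q i - p i) \<le> N" for y
  proof -
    let ?I = "{i\<in>{1..k}. f i = y}"
    have "(\<Sum>i\<in>?I. q i - p i) = (\<Sum>i\<in>?I. card {p i..<q i})" by simp
    also have "\<dots> = card (\<Union>i\<in>?I. {p i..<q i})"
    proof (rule card_UN_disjoint[symmetric])
      show "\<forall>i\<in>?I. \<forall>i'\<in>?I. i \<noteq> i' \<longrightarrow> {p i..<q i} \<inter> {p i'..<q i'} = {}"
      proof (intro ballI impI)
        fix i i' assume i: "i \<in> ?I" "i' \<in> ?I" "i \<noteq> i'"
        then have "q i \<le> p i' \<or> q i' \<le> p i"
          using cls[of i i'] cls[of i' i] by (cases "i < i'") auto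
        then show "{p i..<q i} \<inter> {p i'..<q i'} = {}" by auto
      qed
    qed auto
    also have "\<dots> \<le> card {1..N}"
    proof (rule card_mono)
      show "(\<Union>i\<in>?I. {p i..<q i}) \<subseteq> {1..N}"
      proof
        fix m assume "m \<in> (\<Union>i\<in>?I. {p i..<q i})"
        then obtain i where "i \<in> {1..k}" "p i \<le> m" "m < q i" by auto
        then show "m \<in> {1..N}" using pq[of i] by auto
      qed
    qed simp
    finally show ?thesis by simp
  qed
  then have "(\<Sum>y<c. \<Sum>i\<in>{i\<in>{1..k}. f i = y}. q i - p i) \<le> (\<Sum>y<c. N)"
    by (intro sum_mono)
  also have "(\<Sum>y<c. \<Sum>i\<in>{i\<in>{1..k}. f i = y}. q i - p i) = (\<Sum>i\<in>{1..k}. q i - p i)"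
    by (rule sum.group) (use f in auto)
  finally show ?thesis by simp
qed

text \<open>Passing a row costs at most 6 k + 5, and by \<open>sum_lengths_classes\<close> at most c
  N rows are passed altogether. Each column i adds i for its starting vector and 4 i + 4 for the end
  of its examination, hence at most 5 k + 4.\<close>

lemma time_fia:
  assumes good: "good_start A N start"
    and time: "\<And>st i. time (start st i) = i"
    and f: "\<And>i. f i < c"
    and cls: "\<And>i i'. 1 \<le> i \<Longrightarrow> i < i' \<Longrightarrow> i' \<le> k \<Longrightarrow> f i = f i' \<Longrightarrow>
      stop_row start A N i \<le> start_row start A N i'"
  shows "time (fia start A N k) \<le> N + 1 + k * (5 * k + 4) + c * N * (6 * k + 5)"
proof -
  let ?len = "\<lambda>i. stop_row start A N i - start_row start A N i"
  \<comment> \<open>The constants refer to the final k while k' runs, so that the bound per column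
    is the same in each induction step.\<close>
  have "time (fia start A N k') \<le> N + 1 + k' * (5 * k + 4) + (\<Sum>i\<in>{1..k'}. ?len i) * (6 * k + 5)"
    if "k' \<le> k" for k'
    using that
  proof (induction k')
    case (Suc k')
    have "?len (Suc k') * (6 * Suc k' + 5) \<le> ?len (Suc k') * (6 * k + 5)"
      using Suc.prems by (intro mult_le_mono) auto
    moreover have "5 * Suc k' + 4 \<le> 5 * k + 4" using Suc.prems by simp
    moreover have "(\<Sum>i\<in>{1..Suc k'}. ?len i) * (6 * k + 5) =
      (\<Sum>i\<in>{1..k'}. ?len i) * (6 * k + 5) + ?len (Suc k') * (6 * k + 5)"
      by (simp add: add_mult_distrib)
    moreover have "Suc k' * (5 * k + 4) = k' * (5 * k + 4) + (5 * k + 4)" by simp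
    ultimately show ?case
      using fia_Suc_correct(6)[OF good, of k'] Suc.IH Suc.prems unfolding time by linarith
  qed simp
  from this[of k] have "time (fia start A N k)
    \<le> N + 1 + k * (5 * k + 4) + (\<Sum>i\<in>{1..k}. ?len i) * (6 * k + 5)" by simp
  moreover have "(\<Sum>i\<in>{1..k}. ?len i) \<le> c * N"
    using f cls start_row_le_stop_row[OF good] by (intro sum_lengths_classes[of f]) auto
  then have "(\<Sum>i\<in>{1..k}. ?len i) * (6 * k + 5) \<le> c * N * (6 * k + 5)"
    by (rule mult_le_mono1)
  ultimately show ?thesis by linarith
qed

section \<open>The solutions found by the FIA\<close>

text \<open>Back substitution: a multiple of the vector of length L + 1 removes coordinate L of g,
  and the remainder is supported on fewer coordinates. Functions on all indices avoid cutting
  lists.\<close>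

lemma triangular_basis:
  fixes V :: "nat \<Rightarrow> 'a::field list"
  assumes "\<And>i. i \<in> {1..L} \<Longrightarrow> length (V i) = i \<and> last (V i) \<noteq> 0"
    and "\<And>l. L \<le> l \<Longrightarrow> g l = 0"
  shows "\<exists>b. \<forall>l. g l = (\<Sum>i\<in>{1..L}. b i * nth_default 0 (V i) l)"
  using assms
proof (induction L arbitrary: g)
  case (Suc L)
  let ?w = "V (Suc L)"
  let ?x = "g L / last ?w"
  have w: "length ?w = Suc L" "last ?w \<noteq> 0" using Suc.prems(1)[of "Suc L"] by auto
  have lead: "nth_default 0 ?w L = last ?w"
    using w(1) by (simp add: nth_default_def last_conv_nth flip: length_greater_0_conv)
  have "\<exists>b. \<forall>l. g l - ?x * nth_default 0 ?w l = (\<Sum>i\<in>{1..L}. b i * nth_default 0 (V i) l)"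
  proof (rule Suc.IH)
    show "length (V i) = i \<and> last (V i) \<noteq> 0" if "i \<in> {1..L}" for i
      using Suc.prems(1)[of i] that by simp
    show "g l - ?x * nth_default 0 ?w l = 0" if "L \<le> l" for l
    proof (cases "l = L")
      case True
      then show ?thesis using w(2) lead by simp
    next
      case False
      then show ?thesis using that Suc.prems(2)[of l] w(1) by (simp add: nth_default_def)
    qed
  qed
  then obtain b where
    b: "\<And>l. g l - ?x * nth_default 0 ?w l = (\<Sum>i\<in>{1..L}. b i * nth_default 0 (V i) l)"
    by blast
  let ?b = "b(Suc L := ?x)"
  have "g l = (\<Sum>i\<in>{1..Suc L}. ?b i * nth_default 0 (V i) l)" for l
  proof -
    have "(\<Sum>i\<in>{1..L}. ?b i * nth_default 0 (V i) l) = (\<Sum>i\<in>{1..L}. b i * nth_default 0 (V i) l)"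
      by (intro sum.cong) auto
    then show ?thesis using b[of l] by (simp add: algebra_simps)
  qed
  then show ?case by blast
qed auto

lemma sum_map_filter_upt:
  fixes G :: "nat \<Rightarrow> 'b \<Rightarrow> 'a::comm_monoid_add"
  shows "(\<Sum>h<length (map F (filter P [1..<L + 1])).
      G (filter P [1..<L + 1] ! h) (map F (filter P [1..<L + 1]) ! h)) =
    (\<Sum>i\<in>{i\<in>{1..L}. P i}. G i (F i))"
proof -
  let ?is = "filter P [1..<L + 1]"
  have "(\<Sum>h<length (map F ?is). G (?is ! h) (map F ?is ! h)) = (\<Sum>h<length ?is. G (?is ! h) (F (?is ! h)))"
    by (intro sum.cong) auto
  also have "\<dots> = sum_list (map (\<lambda>i. G i (F i)) ?is)"
    by (simp add: sum_list_sum_nth atLeast0LessThan)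
  also have "\<dots> = (\<Sum>i\<in>set ?is. G i (F i))"
    by (rule sum_list_distinct_conv_sum_set) (simp del: upt_Suc)
  also have "set ?is = {i\<in>{1..L}. P i}" by auto
  finally show ?thesis .
qed

text \<open>The coefficients in \<open>lin_span\<close> are numbered by list positions; numbering
  them by columns makes them comparable with an expansion over all columns.\<close>

lemma lin_span_iff_sum:
  "v \<in> lin_span L (map F (filter P [1..<K + 1])) \<longleftrightarrow>
     length v = L \<and> (\<exists>b. \<forall>l<L. v ! l = (\<Sum>i\<in>{i\<in>{1..K}. P i}. b i * nth_default 0 (F i) l))"
  (is "?lhs \<longleftrightarrow> ?rhs")
proof
  let ?is = "filter P [1..<K + 1]"
  have dist: "distinct ?is" by (simp del: upt_Suc)
  show ?rhs if ?lhs
  proof -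
    from that obtain b where len: "length v = L" and b: "\<And>l. l < L \<Longrightarrow>
      v ! l = (\<Sum>h<length (map F ?is). b h * nth_default 0 (map F ?is ! h) l)"
      unfolding lin_span_def by blast
    \<comment> \<open>The listed columns are distinct, hence a column determines its position in the
      list and inherits the coefficient found there.\<close>
    define b' where "b' i = b (the_inv_into {..<length ?is} ((!) ?is) i)" for i
    have b': "b' (?is ! h) = b h" if "h < length ?is" for h
      unfolding b'_def
      using that inj_on_nth[OF dist, of "{..<length ?is}"]
      by (subst the_inv_into_f_f) (auto simp del: upt_Suc)
    have "v ! l = (\<Sum>i\<in>{i\<in>{1..K}. P i}. b' i * nth_default 0 (F i) l)" if "l < L" for l
    proof -
      have "v ! l = (\<Sum>h<length (map F ?is). b' (?is ! h) * nth_default 0 (map F ?is ! h) l)"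
        unfolding b[OF that] by (intro sum.cong) (simp_all only: length_map lessThan_iff b')
      then show ?thesis
        unfolding sum_map_filter_upt[where G = "\<lambda>i w. b' i * nth_default 0 w l"] .
    qed
    with len show ?thesis by blast
  qed
  show ?lhs if ?rhs
  proof -
    from that obtain b where len: "length v = L" and b: "\<And>l. l < L \<Longrightarrow>
      v ! l = (\<Sum>i\<in>{i\<in>{1..K}. P i}. b i * nth_default 0 (F i) l)" by blast
    show ?thesis
      unfolding lin_span_def mem_Collect_eq
    proof (intro conjI exI[of _ "\<lambda>h. b (?is ! h)"] allI impI)
      show "length v = L" by fact
      show "v ! l = (\<Sum>h<length (map F ?is). b (?is ! h) * nth_default 0 (map F ?is ! h) l)"
        if "l < L" for l
        unfolding b[OF that] sum_map_filter_upt[where G = "\<lambda>i w. b i * nth_default 0 w l"] ..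
    qed
  qed
qed

lemma disc_linear:
  assumes "\<And>l. l < length v \<Longrightarrow> v ! l = (\<Sum>i\<in>I. b i * nth_default 0 (V i) l)"
    and "\<And>i. i \<in> I \<Longrightarrow> length (V i) \<le> length v"
  shows "disc A m v = (\<Sum>i\<in>I. b i * disc A m (V i))"
proof -
  have "disc A m v = (\<Sum>l<length v. \<Sum>i\<in>I. b i * (A m (Suc l) * nth_default 0 (V i) l))"
    unfolding disc_def
    by (intro sum.cong) (simp_all add: assms(1) sum_distrib_left mult.left_commute)
  also have "\<dots> = (\<Sum>i\<in>I. b i * (\<Sum>l<length v. A m (Suc l) * nth_default 0 (V i) l))"
    by (subst sum.swap) (simp add: sum_distrib_left)
  also have "\<dots> = (\<Sum>i\<in>I. b i * disc A m (V i))"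
    using assms(2) by (intro sum.cong) (simp_all add: disc_nth_default[of _ "length v"])
  finally show ?thesis .
qed

lemma fia_inv_col:
  assumes "fia_inv A N k st" "i \<in> {1..k}"
  shows "length (fst (col_store st i)) = i" "last (fst (col_store st i)) \<noteq> 0"
    "1 \<le> snd (col_store st i)" "snd (col_store st i) \<le> N + 1"
    "m \<in> {1..<snd (col_store st i)} \<Longrightarrow> disc A m (fst (col_store st i)) = 0"
    "snd (col_store st i) \<le> N \<Longrightarrow> disc A (snd (col_store st i)) (fst (col_store st i)) \<noteq> 0"
proof -
  have c: "col_store st i = (fst (col_store st i), snd (col_store st i))" by simp
  note col = fia_inv_colD[OF assms c]
  show "length (fst (col_store st i)) = i" "last (fst (col_store st i)) \<noteq> 0"
    "1 \<le> snd (col_store st i)" "snd (col_store st i) \<le> N + 1"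
    "snd (col_store st i) \<le> N \<Longrightarrow> disc A (snd (col_store st i)) (fst (col_store st i)) \<noteq> 0"
    using col by blast+
  show "disc A m (fst (col_store st i)) = 0" if "m \<in> {1..<snd (col_store st i)}"
  proof -
    have "m \<in> {1..snd (col_store st i) - 1}" using that by auto
    with col(5) show ?thesis unfolding solves_disc by blast
  qed
qed

lemma fia_inv_solutions:
  assumes inv: "fia_inv A N k st" and "L \<le> k" "M \<le> N"
  shows "{v. length v = L \<and> solves A M v} =
    lin_span L (map (\<lambda>i. fst (col_store st i)) (filter (\<lambda>i. M < snd (col_store st i)) [1..<L + 1]))"
    (is "?S = ?span")
proof -
  let ?V = "\<lambda>i. fst (col_store st i)" and ?r = "\<lambda>i. snd (col_store st i)"
  have i: "i \<in> {1..k}" if "i \<in> {1..L}" for i using that assms(2) by auto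
  note col = fia_inv_col[OF inv i]
  show ?thesis
  proof (intro equalityI subsetI)
    fix v assume "v \<in> ?S"
    then have len: "length v = L" and sol: "\<And>m. m \<in> {1..M} \<Longrightarrow> disc A m v = 0"
      by (auto simp: solves_disc)
    have "\<exists>b. \<forall>l. nth_default 0 v l = (\<Sum>i\<in>{1..L}. b i * nth_default 0 (?V i) l)"
      by (rule triangular_basis) (use len col(1,2) in \<open>auto simp: nth_default_def\<close>)
    then obtain b where b: "\<And>l. nth_default 0 v l = (\<Sum>i\<in>{1..L}. b i * nth_default 0 (?V i) l)"
      by blast
    have vl: "v ! l = (\<Sum>i\<in>{1..L}. b i * nth_default 0 (?V i) l)" if "l < L" for l
      using b[of l] that len by (simp add: nth_default_def)
    have disc: "disc A m v = (\<Sum>i\<in>{1..L}. b i * disc A m (?V i))" for m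
      by (rule disc_linear) (use vl len col(1) in auto)
    \<comment> \<open>Columns that take part in v although their vectors fail within the first M
      rows.\<close>
    let ?bad = "{i\<in>{1..L}. b i \<noteq> 0 \<and> ?r i \<le> M}"
    have "?bad = {}"
    proof (rule ccontr)
      assume "?bad \<noteq> {}"
      then obtain i0 where i0: "i0 \<in> ?bad" and min: "\<And>i. i \<in> ?bad \<Longrightarrow> ?r i0 \<le> ?r i"
        using ex_has_least_nat[of "\<lambda>i. i \<in> ?bad" _ ?r] by blast
      \<comment> \<open>Any other column that takes part in v fails in a later row, since stored
        rows are distinct and i0 is minimal. Its discrepancy in row \<open>?r i0\<close> is thus
        zero, and only the term of i0 remains.\<close>
      have zero: "b i * disc A (?r i0) (?V i) = 0" if "i \<in> {1..L} - {i0}" for i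
      proof (cases "b i = 0")
        case False
        have "?r i \<noteq> ?r i0"
          using fia_inv_stored_inj[OF inv, of i0 i] i0 that i assms(3) by auto
        moreover have "?r i0 \<le> ?r i"
          using min[of i] i0 that False by (cases "?r i \<le> M") auto
        ultimately have "?r i0 \<in> {1..<?r i}" using col(3)[of i0] i0 by auto
        then show ?thesis using col(5)[of i] that by simp
      qed simp
      have "(\<Sum>i\<in>{1..L} - {i0}. b i * disc A (?r i0) (?V i)) = 0"
        by (intro sum.neutral ballI zero)
      then have "disc A (?r i0) v = b i0 * disc A (?r i0) (?V i0)"
        unfolding disc using i0 by (subst sum.remove[of _ i0]) auto
      then have "disc A (?r i0) v \<noteq> 0"
        using i0 col(6)[of i0] assms(3) by simp
      then show False using sol[of "?r i0"] i0 col(3)[of i0] by simp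
    qed
    then have "v ! l = (\<Sum>i\<in>{i\<in>{1..L}. M < ?r i}. b i * nth_default 0 (?V i) l)" if "l < L" for l
      unfolding vl[OF that] by (intro sum.mono_neutral_right) auto
    then show "v \<in> ?span" unfolding lin_span_iff_sum using len by blast
  next
    fix v assume "v \<in> ?span"
    then obtain b where len: "length v = L" and
      b: "\<And>l. l < L \<Longrightarrow> v ! l = (\<Sum>i\<in>{i\<in>{1..L}. M < ?r i}. b i * nth_default 0 (?V i) l)"
      unfolding lin_span_iff_sum by blast
    have "disc A m v = 0" if "m \<in> {1..M}" for m
    proof -
      have "disc A m v = (\<Sum>i\<in>{i\<in>{1..L}. M < ?r i}. b i * disc A m (?V i))"
        by (rule disc_linear) (use b len col(1) in auto)
      also have "\<dots> = 0" using that col(5) by (intro sum.neutral) auto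
      finally show ?thesis .
    qed
    with len show "v \<in> ?S" by (simp add: solves_disc)
  qed
qed

text \<open>The solution sets come from \<open>fia_inv_solutions\<close>. The list is nonempty by
  the pigeonhole principle: 2 \<tau> + 1 columns cannot all be stored for distinct rows among the
  first 2 \<tau>.\<close>

lemma fia_inv_finds_all_solutions:
  assumes inv: "fia_inv A (2 * T) (2 * T + 1) st"
  shows "finds_all_solutions A T st"
  unfolding finds_all_solutions_def
proof (intro allI impI conjI ballI)
  fix \<tau> assume \<tau>: "\<tau> \<le> T"
  have upt: "[1..<2 * \<tau> + 2] = [1..<(2 * \<tau> + 1) + 1]" by (simp del: upt_Suc)
  show "subsystem_solutions A \<tau> = lin_span (2 * \<tau> + 1) (fia_solutions st \<tau>)"
    unfolding subsystem_solutions_def fia_solutions_def upt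
    by (rule fia_inv_solutions[OF inv]) (use \<tau> in simp_all)
  show "fia_solutions st \<tau> \<noteq> []"
  proof
    assume "fia_solutions st \<tau> = []"
    then have small: "snd (col_store st i) \<le> 2 * \<tau>" if "i \<in> {1..2 * \<tau> + 1}" for i
      using that unfolding fia_solutions_def
      by (auto simp: filter_empty_conv not_less simp del: upt_Suc)
    have i: "i \<in> {1..2 * T + 1}" if "i \<in> {1..2 * \<tau> + 1}" for i using that \<tau> by auto
    have "inj_on (\<lambda>i. snd (col_store st i)) {1..2 * \<tau> + 1}"
    proof (rule inj_onI)
      fix i i' assume ii: "i \<in> {1..2 * \<tau> + 1}" "i' \<in> {1..2 * \<tau> + 1}"
        and eq: "snd (col_store st i) = snd (col_store st i')"
      have "snd (col_store st i) \<le> 2 * T" using small[OF ii(1)] \<tau> by simp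
      then show "i = i'" by (rule fia_inv_stored_inj[OF inv i[OF ii(1)] i[OF ii(2)] eq])
    qed
    moreover have "(\<lambda>i. snd (col_store st i)) ` {1..2 * \<tau> + 1} \<subseteq> {1..2 * \<tau>}"
    proof (rule image_subsetI)
      fix x assume x: "x \<in> {1..2 * \<tau> + 1}"
      show "snd (col_store st x) \<in> {1..2 * \<tau>}"
        using small[OF x] fia_inv_col(3)[OF inv i[OF x]] by simp
    qed
    ultimately have "card {1..2 * \<tau> + 1} \<le> card {1..2 * \<tau>}"
      by (intro card_inj_on_le) auto
    then show False by simp
  qed
  fix v assume "v \<in> set (fia_solutions st \<tau>)"
  then obtain i where "i \<in> set [1..<2 * \<tau> + 2]" and v: "v = fst (col_store st i)"
    unfolding fia_solutions_def set_map set_filter by blast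
  then have i: "i \<in> {1..2 * T + 1}" using \<tau> by auto
  have "length v = i" "last v \<noteq> 0" using fia_inv_col(1,2)[OF inv i] v by simp_all
  then show "v \<noteq> []" "last v \<noteq> 0" using i by auto
qed

section \<open>Polynomials represented by vectors\<close>

lemma solves_eval_matrix:
  "solves (eval_matrix t1 D1 D2 xs) j v \<longleftrightarrow>
     (\<forall>m\<in>{1..j}. poly (represents t1 D1 D2 v) (xs ! (m - 1)) = 0)"
  unfolding solves_def represents_def eval_matrix_def
  by (simp add: poly_sum mult.commute)

text \<open>The multiples of D1 occupy adjacent columns as far as column 2 t1. Later the multiples
  of D1 and D2 alternate, so the next power stands two columns further. Column 2 t1 already belongs
  to the second kind, because column 2 t1 + 1 starts the multiples of D2.\<close>

lemma col_poly_shift: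
  assumes "1 \<le> t1"
  shows "1 \<le> i \<Longrightarrow> i < 2 * t1 \<Longrightarrow> col_poly t1 D1 D2 (Suc i) = [:0, 1:] * col_poly t1 D1 D2 i"
    and "2 * t1 \<le> i \<Longrightarrow> col_poly t1 D1 D2 (Suc (Suc i)) = [:0, 1:] * col_poly t1 D1 D2 i"
proof -
  assume i: "1 \<le> i" "i < 2 * t1"
  then obtain h where "i = Suc h" by (cases i) auto
  with i show "col_poly t1 D1 D2 (Suc i) = [:0, 1:] * col_poly t1 D1 D2 i"
    by (simp add: col_poly_def monom_Suc)
next
  assume "2 * t1 \<le> i"
  then consider (first) "i = 2 * t1"
    | (odd) h where "i = 2 * t1 + 1 + 2 * h"
    | (even) h where "i = 2 * t1 + 2 + 2 * h"
  proof -
    obtain x where x: "i = 2 * t1 + x" using \<open>2 * t1 \<le> i\<close> le_Suc_ex by blast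
    consider "x = 0" | h where "x = 1 + 2 * h" | h where "x = 2 + 2 * h"
      by (cases x) (metis evenE oddE Suc_eq_plus1 add.commute add_2_eq_Suc old.nat.exhaust mult_0_right)+
    then show thesis using that x by cases (auto simp: add.assoc)
  qed
  then show "col_poly t1 D1 D2 (Suc (Suc i)) = [:0, 1:] * col_poly t1 D1 D2 i"
  proof cases
    \<comment> \<open>The two columns fall into different branches of \<open>col_poly\<close>:
      exponent 2 t1 - 1 comes from the first branch, exponent 2 t1 from the last.\<close>
    case first
    obtain h where "2 * t1 = Suc h" using assms by (cases "2 * t1") auto
    moreover have "odd h" using \<open>2 * t1 = Suc h\<close> by presburger
    ultimately show ?thesis using first by (simp add: col_poly_def monom_Suc)
  next
    case odd
    have "(2 + 2 * h) div 2 = Suc h" by simp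
    with odd show ?thesis by (simp add: col_poly_def monom_Suc)
  next
    case even
    have "(2 + 2 * h) div 2 = Suc h" by simp
    with even show ?thesis by (simp add: col_poly_def monom_Suc)
  qed
qed

section \<open>Padding as multiplication by x\<close>

lemma sum_lessThan_append:
  fixes g :: "nat \<Rightarrow> 'a \<Rightarrow> 'b::comm_monoid_add"
  shows "(\<Sum>l<length (u @ w). g l ((u @ w) ! l)) =
    (\<Sum>l<length u. g l (u ! l)) + (\<Sum>l<length w. g (length u + l) (w ! l))"
proof (induction w rule: rev_induct)
  case Nil
  then show ?case by simp
next
  case (snoc x w)
  have "(\<Sum>l<length (u @ w). g l ((u @ (w @ [x])) ! l)) = (\<Sum>l<length (u @ w). g l ((u @ w) ! l))"
    by (intro sum.cong) (auto simp: nth_append)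
  moreover have "(\<Sum>l<length w. g (length u + l) ((w @ [x]) ! l)) =
    (\<Sum>l<length w. g (length u + l) (w ! l))"
    by (intro sum.cong) (auto simp: nth_append)
  moreover have "(u @ (w @ [x])) ! (length u + length w) = x"
    by (simp add: nth_append)
  ultimately show ?case using snoc by (simp add: add.assoc)
qed

lemma represents_Cons_0:
  assumes "1 \<le> t1" "length v < 2 * t1"
  shows "represents t1 D1 D2 (0 # v) = [:0, 1:] * represents t1 D1 D2 v"
proof -
  have "represents t1 D1 D2 (0 # v) =
    (\<Sum>l<length v. smult (v ! l) (col_poly t1 D1 D2 (Suc (Suc l))))"
    by (simp add: represents_def sum.lessThan_Suc_shift del: sum.lessThan_Suc)
  also have "\<dots> = (\<Sum>l<length v. [:0, 1:] * smult (v ! l) (col_poly t1 D1 D2 (Suc l)))"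
    using assms by (intro sum.cong) (simp_all add: col_poly_shift(1))
  finally show ?thesis by (simp only: represents_def sum_distrib_left)
qed

lemma length_pad: "1 \<le> t1 \<Longrightarrow> 2 * t1 \<le> length v \<Longrightarrow> length (pad t1 v) = length v + 2"
  by (simp add: pad_def)

text \<open>The vector is cut before its entry of column 2 t1: the first 2 t1 - 1 entries move by
  one column, the others by two, as in \<open>col_poly_shift\<close>. The zeros fill columns 1 and 2
  t1 + 1, to which no entry moves.\<close>

lemma represents_pad:
  assumes t1: "1 \<le> t1" and len: "2 * t1 \<le> length v"
  shows "represents t1 D1 D2 (pad t1 v) = [:0, 1:] * represents t1 D1 D2 v"
proof -
  let ?u = "take (2 * t1 - 1) v" and ?w = "drop (2 * t1 - 1) v"
  let ?g = "\<lambda>l x. smult x (col_poly t1 D1 D2 (Suc l))"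
  have u: "length ?u = 2 * t1 - 1" using len by simp
  have two: "2 * t1 - 1 + 1 = 2 * t1" using t1 by simp
  have "represents t1 D1 D2 (pad t1 v) = (\<Sum>l<length ((0 # ?u) @ (0 # ?w)). ?g l (((0 # ?u) @ (0 # ?w)) ! l))"
    by (simp add: represents_def pad_def)
  also have "\<dots> = (\<Sum>l<length (0 # ?u). ?g l ((0 # ?u) ! l)) +
      (\<Sum>l<length (0 # ?w). ?g (length (0 # ?u) + l) ((0 # ?w) ! l))"
    by (rule sum_lessThan_append)
  also have "(\<Sum>l<length (0 # ?u). ?g l ((0 # ?u) ! l)) = represents t1 D1 D2 (0 # ?u)"
    by (simp add: represents_def)
  also have "\<dots> = [:0, 1:] * (\<Sum>l<length ?u. ?g l (?u ! l))"
    using u t1 by (subst represents_Cons_0) (simp_all add: represents_def)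
  also have "(\<Sum>l<length (0 # ?w). ?g (length (0 # ?u) + l) ((0 # ?w) ! l)) =
    (\<Sum>l<length ?w. ?g (Suc (2 * t1 + l)) (?w ! l))"
    using u t1 by (simp add: sum.lessThan_Suc_shift del: sum.lessThan_Suc length_take length_drop)
  also have "\<dots> = (\<Sum>l<length ?w. [:0, 1:] * ?g (length ?u + l) (?w ! l))"
  proof (intro sum.cong refl)
    fix l
    have "Suc (length ?u + l) = 2 * t1 + l" using u t1 by simp
    then show "?g (Suc (2 * t1 + l)) (?w ! l) = [:0, 1:] * ?g (length ?u + l) (?w ! l)"
      by (simp only: mult_smult_right col_poly_shift(2)[OF t1 le_add1])
  qed
  also have "[:0, 1:] * (\<Sum>l<length ?u. ?g l (?u ! l)) + \<dots> =
    [:0, 1:] * (\<Sum>l<length (?u @ ?w). ?g l ((?u @ ?w) ! l))"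
    by (simp only: sum_lessThan_append[where g = ?g and u = ?u and w = ?w]
        sum_distrib_left distrib_left)
  also have "?u @ ?w = v" by simp
  finally show ?thesis by (simp add: represents_def)
qed

lemma solves_shifted:
  assumes "represents t1 D1 D2 w = [:0, 1:] * represents t1 D1 D2 v"
    and "solves (eval_matrix t1 D1 D2 xs) j v"
  shows "solves (eval_matrix t1 D1 D2 xs) j w"
  using assms by (simp add: solves_eval_matrix)

section \<open>The two choices of starting vectors\<close>

lemma time_basic_start: "time (basic_start st i) = i"
  by (simp add: basic_start_def)

lemma time_modified_start: "time (modified_start t1 st i) = i"
  by (simp add: modified_start_def time_basic_start split: prod.split)

lemma good_basic_start: "good_start A N basic_start"
  by (simp add: good_start_def basic_start_def solves_def)

text \<open>Multiplication by x keeps the zeros of a polynomial. A vector stored for row j solves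
  the equations above row j, and so does its padded form, which is why the examination can resume in
  row j.\<close>

lemma good_modified_start:
  assumes t1: "1 \<le> t1"
  shows "good_start (eval_matrix t1 D1 D2 xs) N (modified_start t1)"
  unfolding good_start_def
proof (intro allI impI)
  fix k st v j
  let ?A = "eval_matrix t1 D1 D2 xs"
  assume inv: "fia_inv ?A N k st" and start: "val (modified_start t1 st (Suc k)) = (v, j)"
  consider (fresh) "k = 0 \<or> k = 2 * t1" | (low) "1 \<le> k" "k < 2 * t1" | (high) "2 * t1 < k"
    by linarith
  then show "length v = Suc k \<and> last v \<noteq> 0 \<and> 1 \<le> j \<and> j \<le> N + 1 \<and> solves ?A (j - 1) v"
  proof cases
    case fresh
    then show ?thesis using start by (auto simp: modified_start_def basic_start_def solves_def)
  next
    case low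
    obtain w where c: "col_store st k = (w, j)" and v: "v = 0 # w"
      using start low by (auto simp: modified_start_def split: prod.splits)
    have "k \<in> {1..k}" using low by simp
    note col = fia_inv_colD[OF inv this c]
    have "solves ?A (j - 1) v"
      unfolding v by (rule solves_shifted[OF represents_Cons_0[OF t1] col(5)]) (use col(1) low in simp)
    then show ?thesis using col low v by auto
  next
    case high
    \<comment> \<open>Column k + 1 takes its vector from column k - 1, whose length k - 1 is at
      least 2 t1, as padding requires.\<close>
    obtain w where c: "col_store st (k - 1) = (w, j)" and v: "v = pad t1 w"
      using start high by (auto simp: modified_start_def split: prod.splits)
    have "k - 1 \<in> {1..k}" using high t1 by simp
    note col = fia_inv_colD[OF inv this c]
    have len: "2 * t1 \<le> length w" using col(1) high by simp
    have "solves ?A (j - 1) v"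
      unfolding v by (rule solves_shifted[OF represents_pad[OF t1 len] col(5)])
    moreover have "last v \<noteq> 0"
      using col(2) len t1 unfolding v pad_def by (simp add: last_append last_drop)
    moreover have "length v = Suc k" using length_pad[OF t1 len] col(1) high v by simp
    ultimately show ?thesis using col(3,4) by simp
  qed
qed

text \<open>A column resumes exactly in the row where its predecessor stopped, column i' - 1 for 2
  \<le> i' \<le> 2 t1 and column i' - 2 beyond 2 t1 + 1; the claim follows by chaining. Even columns
  beyond 2 t1 continue column 2 t1, which joins them to the first class.\<close>

lemma modified_start_classes:
  assumes t1: "1 \<le> t1" and good: "good_start A N (modified_start t1)"
    and "1 \<le> i" "i < i'"
    and "(i \<le> 2 * t1 \<or> even i) = (i' \<le> 2 * t1 \<or> even i')"
  shows "stop_row (modified_start t1) A N i \<le> start_row (modified_start t1) A N i'"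
  using assms(3-5)
proof (induction i' rule: less_induct)
  case (less i')
  let ?start = "start_row (modified_start t1) A N" and ?stop = "stop_row (modified_start t1) A N"
  have step: "?stop i \<le> ?start i'"
    if "?start i' = ?stop p" "i \<le> p" "p < i'" "(p \<le> 2 * t1 \<or> even p) = (i' \<le> 2 * t1 \<or> even i')" for p
  proof (cases "i = p")
    case False
    then have "?stop i \<le> ?start p" using less that by (intro less.IH) auto
    also have "\<dots> \<le> ?stop p"
      using start_row_le_stop_row(2)[OF good, of p] less.prems that by simp
    finally show ?thesis using that by simp
  qed (use that in simp)
  consider (low) "i' \<le> 2 * t1" | (middle) "i' = 2 * t1 + 1" | (high) "2 * t1 + 2 \<le> i'"
    by linarith
  then show ?case
  proof cases
    case low
    then have "?start i' = snd (col_store (val (fia (modified_start t1) A N (i' - 1))) (i' - 1))"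
      using less.prems by (simp add: start_row_def modified_start_def split: prod.split)
    then have "?start i' = ?stop (i' - 1)" by (simp add: stop_row_def)
    then show ?thesis by (rule step) (use low less.prems in auto)
  next
    \<comment> \<open>Column 2 t1 + 1 opens the second class; no earlier column belongs to
      it.\<close>
    case middle
    then show ?thesis using less.prems by simp
  next
    case high
    then have "?start i' = snd (col_store (val (fia (modified_start t1) A N (i' - 1))) (i' - 2))"
      using less.prems t1 by (simp add: start_row_def modified_start_def split: prod.split)
    then have eq: "?start i' = ?stop (i' - 2)" by (simp add: snd_col_store_fia[OF good])
    have "i \<noteq> i' - 1"
    \<comment> \<open>Adjacent columns beyond 2 t1 differ in parity and hence in class, so an
      earlier column of the class is at most i' - 2.\<close>
    proof
      assume "i = i' - 1"
      then have "i' = Suc i" using less.prems by simp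
      then show False using less.prems high by simp
    qed
    moreover have "i' - 2 + 2 = i'" using high by simp
    then obtain p where p: "i' = Suc (Suc p)" by (metis add_2_eq_Suc')
    ultimately show ?thesis using eq high less.prems(2,3) by (intro step[of p]) auto
  qed
qed

section \<open>The extended Euclidean algorithm\<close>

declare eea_loop.simps [simp del]

text \<open>The last equation is the classical degree relation for the cofactors of the Euclidean
  algorithm; through it, degrees of u can be read off from degrees of remainders. Zero polynomials
  are treated separately, their \<open>degree\<close> being 0.\<close>

definition eea_ok :: "nat \<Rightarrow> 'a::field poly \<Rightarrow> 'a poly \<Rightarrow> 'a poly \<Rightarrow> 'a poly \<Rightarrow> bool" where
  "eea_ok d r' r u' u \<longleftrightarrow> r' \<noteq> 0 \<and> (r = 0 \<or> degree r < degree r') \<and>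
     u \<noteq> 0 \<and> (u' = 0 \<or> degree u' < degree u) \<and> degree u + degree r' = d - 1"

abbreviation eea_ok_at :: "nat \<Rightarrow> 'a::field poly \<Rightarrow> nat \<Rightarrow> bool" where
  "eea_ok_at d S i \<equiv>
     eea_ok d (eea_r d S i) (eea_r d S (Suc i)) (eea_u d S i) (eea_u d S (Suc i))"

abbreviation eea_stops :: "nat \<Rightarrow> nat \<Rightarrow> 'a::field poly \<Rightarrow> nat \<Rightarrow> bool" where
  "eea_stops b d S i \<equiv> eea_r d S (Suc i) = 0 \<or>
     b < degree (eea_u d S (Suc i)) + (degree (eea_r d S i) - degree (eea_r d S (Suc i)))"

lemma degree_div_field:
  fixes p r :: "'a::field poly"
  assumes "r \<noteq> 0" "degree r < degree p"
  shows "p div r \<noteq> 0" "degree (p div r) = degree p - degree r"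
proof -
  have eq: "p div r * r + p mod r = p" by (rule div_mult_mod_eq)
  have mod: "p mod r = 0 \<or> degree (p mod r) < degree r" by (rule degree_mod_less[OF assms(1)])
  show nz: "p div r \<noteq> 0"
  proof
    assume "p div r = 0"
    then have "p mod r = p" using eq by simp
    then show False using mod assms(2) by auto
  qed
  have deg: "degree (p div r * r) = degree (p div r) + degree r"
    using nz assms(1) by (rule degree_mult_eq)
  have "degree p = degree (p div r * r)"
  proof (cases "p mod r = 0")
    case True
    then show ?thesis using eq by simp
  next
    case False
    then have "degree (p mod r) < degree (p div r * r)" using mod deg by simp
    then show ?thesis using degree_add_eq_left[of "p mod r" "p div r * r"] eq by simp
  qed
  with deg show "degree (p div r) = degree p - degree r" by simp
qed

text \<open>The quotient has positive degree, so (r' div r) * u has larger degree than u and hence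
  than u'; nothing cancels and the degrees add.\<close>

lemma eea_ok_step:
  assumes ok: "eea_ok d r' r u' u" and r: "r \<noteq> 0"
  shows "eea_ok d r (r' mod r) u (u' - (r' div r) * u)"
    and "degree (r' div r) = degree r' - degree r"
    and "degree (u' - (r' div r) * u) = degree u + (degree r' - degree r)"
proof -
  have lt: "degree r < degree r'" and u: "u \<noteq> 0" "u' = 0 \<or> degree u' < degree u"
    and sum: "degree u + degree r' = d - 1"
    using ok r by (auto simp: eea_ok_def)
  note q = degree_div_field[OF r lt]
  show "degree (r' div r) = degree r' - degree r" by (rule q(2))
  have qu: "degree (r' div r * u) = degree u + (degree r' - degree r)"
    using q u(1) by (simp add: degree_mult_eq)
  show deg: "degree (u' - r' div r * u) = degree u + (degree r' - degree r)"
  proof (cases "u' = 0")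
    case True
    then show ?thesis using qu by simp
  next
    case False
    then have "degree u' < degree (- (r' div r * u))" using u(2) qu by simp
    then have "degree (u' + - (r' div r * u)) = degree (- (r' div r * u))"
      by (rule degree_add_eq_right)
    then show ?thesis using qu by simp
  qed
  then have "degree u < degree (u' - r' div r * u)" using lt by simp
  moreover from this have "u' - r' div r * u \<noteq> 0" by force
  ultimately show "eea_ok d r (r' mod r) u (u' - r' div r * u)"
    using degree_mod_less[OF r, of r'] deg lt sum r unfolding eea_ok_def by auto
qed

text \<open>The cost is charged to the degree of the quotient, by which u grows. As this growth sums
  up to at most b over the loop, the total is quadratic in d. The four summands take 1, 4, 1 and 4
  times d per unit of degree.\<close>

lemma eea_step_cost:
  assumes ok: "eea_ok d r' r u' u" and r: "r \<noteq> 0" and d: "1 \<le> d"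
  shows "div_cost r' r + mult_sub_cost u' (r' div r) u \<le> (degree r' - degree r) * (10 * d)"
proof -
  define D where "D = degree r' - degree r"
  have lt: "degree r < degree r'" and u: "degree u' \<le> degree u"
    and sum: "degree u + degree r' = d - 1"
    using ok r by (auto simp: eea_ok_def)
  have D: "1 \<le> D" using lt by (simp add: D_def)
  have "degree r' + 1 \<le> D * d" using sum d mult_le_mono1[OF D, of d] by linarith
  moreover have "(D + 1) * (2 * degree r + 3) \<le> (2 * D) * (2 * d)"
    using D lt sum d by (intro mult_le_mono) auto
  moreover have "degree r' + 1 - degree r = D + 1" using lt by (simp add: D_def)
  moreover have "degree u' + 1 \<le> D * d" using u sum d mult_le_mono1[OF D, of d] by linarith
  moreover have "2 * (D + 1) * (degree u + 1) \<le> (4 * D) * d"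
    by (rule mult_le_mono) (use D sum d in auto)
  ultimately show ?thesis
    unfolding div_cost_def mult_sub_cost_def eea_ok_step(2)[OF ok r] D_def[symmetric] by simp
qed

text \<open>The growth of degree u telescopes, so the step costs add up to the bound. That no
  earlier index stops is recorded in order to identify k with the least index in
  \<open>i_B\<close>.\<close>

lemma eea_loop_correct:
  fixes d b :: nat and S :: "'a::field poly"
  assumes d: "1 \<le> d" and "eea_ok_at d S i" and "degree (eea_u d S (Suc i)) \<le> b"
  defines "run \<equiv> \<lambda>i. eea_loop b (eea_r d S i) (eea_r d S (Suc i)) (eea_u d S i) (eea_u d S (Suc i))"
  shows "\<exists>k. val (run i) = (eea_r d S k, eea_r d S (Suc k), eea_u d S k, eea_u d S (Suc k)) \<and>
     eea_ok_at d S k \<and> degree (eea_u d S (Suc k)) \<le> b \<and> eea_stops b d S k \<and>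
     (\<forall>h. i \<le> h \<and> h < k \<longrightarrow> eea_ok_at d S h \<and> \<not> eea_stops b d S h) \<and>
     time (run i) \<le> 1 + (b - degree (eea_u d S (Suc i))) * (10 * d)"
  using assms(2,3)
proof (induction "b - degree (eea_u d S (Suc i))" arbitrary: i rule: less_induct)
  case less
  let ?r' = "eea_r d S i" and ?r = "eea_r d S (Suc i)" and ?u' = "eea_u d S i"
    and ?u = "eea_u d S (Suc i)"
  show ?case
  proof (cases "eea_stops b d S i")
    case True
    then have "run i = TM (?r', ?r, ?u', ?u) 1"
      unfolding run_def by (subst eea_loop.simps) auto
    then show ?thesis using less.prems True by (intro exI[of _ i]) auto
  next
    case False
    then have r: "?r \<noteq> 0" and le: "degree ?u + (degree ?r' - degree ?r) \<le> b" by auto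
    have next_u: "eea_u d S (Suc (Suc i)) = ?u' - (?r' div ?r) * ?u"
      by (simp add: eea_q_def)
    have run: "run i = tick (div_cost ?r' ?r + mult_sub_cost ?u' (?r' div ?r) ?u) (run (Suc i))"
      unfolding run_def using False by (subst eea_loop.simps) (auto simp: eea_q_def)
    note step = eea_ok_step[OF less.prems(1) r]
    have lt: "degree ?r < degree ?r'" using less.prems(1) r by (auto simp: eea_ok_def)
    have deg: "degree (eea_u d S (Suc (Suc i))) = degree ?u + (degree ?r' - degree ?r)"
      using step(3) by (simp only: next_u)
    have ok: "eea_ok_at d S (Suc i)" using step(1) by (simp add: eea_q_def)
    have decr: "b - degree (eea_u d S (Suc (Suc i))) < b - degree ?u"
      and next_le: "degree (eea_u d S (Suc (Suc i))) \<le> b"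
      using le lt unfolding deg by linarith+
    obtain k where k: "val (run (Suc i)) = (eea_r d S k, eea_r d S (Suc k), eea_u d S k, eea_u d S (Suc k))"
      "eea_ok_at d S k" "degree (eea_u d S (Suc k)) \<le> b" "eea_stops b d S k"
      "\<And>h. Suc i \<le> h \<Longrightarrow> h < k \<Longrightarrow> eea_ok_at d S h \<and> \<not> eea_stops b d S h"
      "time (run (Suc i)) \<le> 1 + (b - degree (eea_u d S (Suc (Suc i)))) * (10 * d)"
      using less.hyps[OF decr ok next_le] by blast
    have "b - degree ?u = (degree ?r' - degree ?r) + (b - degree (eea_u d S (Suc (Suc i))))"
      using deg le by simp
    then have "(b - degree ?u) * (10 * d) =
      (degree ?r' - degree ?r) * (10 * d) + (b - degree (eea_u d S (Suc (Suc i)))) * (10 * d)"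
      by (simp only: add_mult_distrib)
    then have time: "time (run i) \<le> 1 + (b - degree ?u) * (10 * d)"
      using eea_step_cost[OF less.prems(1) r d] k(6) unfolding run tick_def by simp
    have "eea_ok_at d S h \<and> \<not> eea_stops b d S h" if "i \<le> h" "h < k" for h
    proof (cases "h = i")
      case True
      show ?thesis unfolding True using less.prems(1) False by blast
    qed (use k(5)[of h] that in simp)
    moreover have "val (run i) = val (run (Suc i))" by (simp add: run tick_def)
    ultimately show ?thesis using k(1-4) time by (intro exI[of _ k]) simp
  qed
qed

text \<open>For negative c the quantity subtracted in \<open>next_deg\<close> is
  \<open>eea_s\<close>, that is degree u - 1, so degree u cancels and degree r' + 1 is left. This is
  the form in which \<open>basis_tm\<close> computes t1.\<close>

lemma next_deg_eq:
  assumes ok: "eea_ok_at d S i"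
  shows "next_deg d S i = int (degree (eea_r d S i)) +
    (if eea_c d S i < 0 then 1
     else int (degree (eea_u d S (Suc i))) - int (degree (eea_r d S (Suc i))))"
proof (cases "eea_c d S i < 0")
  case True
  then show ?thesis by (auto simp: next_deg_def eea_c_def eea_s_def)
next
  case False
  then have r: "eea_r d S (Suc i) \<noteq> 0" by (auto simp: eea_c_def)
  then have "degree (eea_r d S (Suc i)) < degree (eea_r d S i)"
    using ok by (auto simp: eea_ok_def)
  with False eea_ok_step(3)[OF ok r] show ?thesis
    by (simp add: next_deg_def eea_q_def of_nat_diff)
qed

text \<open>For c \<ge> 0 both sides are the same inequality. For c < 0 both hold: degree u \<le> b
  forces degree r' \<ge> b, hence degree r' + 1 > b, and either r = 0 or degree u exceeds degree r
  by more than 1.\<close>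

lemma next_deg_gt_iff_stops:
  assumes ok: "eea_ok_at d S i" and "degree (eea_u d S (Suc i)) \<le> b" and b: "b = (d - 1) div 2"
  shows "int b < next_deg d S i \<longleftrightarrow> eea_stops b d S i"
proof -
  have sum: "degree (eea_u d S (Suc i)) + degree (eea_r d S i) = d - 1"
    and lt: "eea_r d S (Suc i) \<noteq> 0 \<Longrightarrow> degree (eea_r d S (Suc i)) < degree (eea_r d S i)"
    using ok by (auto simp: eea_ok_def)
  have "b \<le> degree (eea_r d S i)" using sum assms(2) b by linarith
  then show ?thesis
    unfolding next_deg_eq[OF ok] using lt
    by (cases "eea_r d S (Suc i) = 0") (auto simp: eea_c_def eea_s_def)
qed

lemma i_B_eqI:
  assumes "eea_ok_at d S k" "degree (eea_u d S (Suc k)) \<le> b" "eea_stops b d S k"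
    and "\<And>h. h < k \<Longrightarrow> eea_ok_at d S h \<and> \<not> eea_stops b d S h" and b: "b = (d - 1) div 2"
  shows "i_B d S = k"
  unfolding i_B_def b[symmetric]
proof (rule Least_equality)
  show "degree (eea_u d S (Suc k)) \<le> b \<and> int b < next_deg d S k"
    using next_deg_gt_iff_stops[OF assms(1,2) b] assms(2,3) by blast
  fix h assume h: "degree (eea_u d S (Suc h)) \<le> b \<and> int b < next_deg d S h"
  show "k \<le> h"
  proof (rule ccontr)
    assume "\<not> k \<le> h"
    then have "eea_ok_at d S h" "\<not> eea_stops b d S h" using assms(4)[of h] by auto
    then show False using next_deg_gt_iff_stops[of d S h b] h b by blast
  qed
qed

section \<open>The basis polynomials and their cost\<close>

lemma degree_high_part_le: "degree (high_part k q) \<le> degree q"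
  unfolding high_part_def
  by (rule degree_le) (auto simp: coeff_poly_cutoff coeff_eq_0)

text \<open>The loop ends at index \<open>i_B d S\<close>, since its test agrees with the condition
  on \<open>next_deg\<close> and fails at all earlier indices. The loop takes at most 1 + 5 d^2
  steps, the computation of \<open>Delta2\<close> at most 7 d^2.\<close>

lemma basis_tm_correct:
  assumes d: "1 \<le> d" and S: "S = 0 \<or> degree S < d - 1"
  shows "val (basis_tm d S) = (t_1 d S, Delta1 d S, Delta2 d S)"
    and "time (basis_tm d S) \<le> 14 * d\<^sup>2"
    and "degree (Delta1 d S) \<le> (d - 1) div 2"
    and "degree (Delta2 d S) < d"
    and "1 \<le> t_1 d S"
    and "next_deg d S (i_B d S) = int ((d - 1) div 2 + t_1 d S)"
proof -
  define b where "b = (d - 1) div 2"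
  have ok0: "eea_ok_at d S 0"
    using S by (auto simp: eea_ok_def degree_monom_eq)
  obtain k where k: "val (eea_loop b (monom 1 (d - 1)) S 0 1) =
      (eea_r d S k, eea_r d S (Suc k), eea_u d S k, eea_u d S (Suc k))"
    and ok: "eea_ok_at d S k" and deg: "degree (eea_u d S (Suc k)) \<le> b" and stop: "eea_stops b d S k"
    and before: "\<And>h. h < k \<Longrightarrow> eea_ok_at d S h \<and> \<not> eea_stops b d S h"
    and time: "time (eea_loop b (monom 1 (d - 1)) S 0 1) \<le> 1 + b * (10 * d)"
    using eea_loop_correct[OF d ok0, of b] by auto
  have iB: "i_B d S = k" by (rule i_B_eqI[OF ok deg stop before b_def])
  let ?r' = "eea_r d S k" and ?r = "eea_r d S (Suc k)" and ?u' = "eea_u d S k"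
    and ?u = "eea_u d S (Suc k)"
  let ?c = "eea_c d S k" and ?q = "high_part (nat (eea_c d S k)) (?r' div ?r)"
  have c: "(if ?r = 0 then -1 else int (degree ?r) - (int (degree ?u) - 1)) = ?c"
    by (simp add: eea_c_def eea_s_def)
  have t1: "nat (int (degree ?r') - int b + (if ?c < 0 then 1 else int (degree ?u) - int (degree ?r))) =
      t_1 d S"
    unfolding t_1_def iB next_deg_eq[OF ok] b_def[symmetric] by (intro arg_cong[of _ _ nat]) simp
  have basis: "basis_tm d S = TM (t_1 d S, ?u, if ?c \<le> 0 then ?u' else ?u' - ?q * ?u)
      (time (eea_loop b (monom 1 (d - 1)) S 0 1) +
       (if ?c \<le> 0 then 1 else div_cost ?r' ?r + mult_sub_cost ?u' ?q ?u))"
    unfolding basis_tm_def b_def[symmetric] Let_def bind_tm_def k prod.case c t1 by simp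
  show "val (basis_tm d S) = (t_1 d S, Delta1 d S, Delta2 d S)"
    by (simp add: basis Delta1_def Delta2_def iB Let_def eea_q_def)
  show "degree (Delta1 d S) \<le> (d - 1) div 2"
    using deg by (simp add: Delta1_def iB b_def)
  have "int b < next_deg d S k" using next_deg_gt_iff_stops[OF ok deg b_def] stop by blast
  then show "1 \<le> t_1 d S" "next_deg d S (i_B d S) = int ((d - 1) div 2 + t_1 d S)"
    unfolding t_1_def iB b_def[symmetric] by simp_all
  have u': "degree ?u' \<le> degree ?u" and sum: "degree ?u + degree ?r' = d - 1"
    using ok by (auto simp: eea_ok_def)
  have q: "degree ?q \<le> degree ?r' - degree ?r" if "?r \<noteq> 0"
  proof -
    have "degree ?q \<le> degree (?r' div ?r)" by (rule degree_high_part_le)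
    also have "\<dots> = degree ?r' - degree ?r" by (rule eea_ok_step(2)[OF ok that])
    finally show ?thesis .
  qed
  have nz: "?r \<noteq> 0" if "0 < ?c" using that by (auto simp: eea_c_def)
  show "degree (Delta2 d S) < d"
  proof (cases "?c \<le> 0")
    case True
    then show ?thesis using u' sum d by (simp add: Delta2_def iB)
  next
    case False
    have "degree (?q * ?u) \<le> degree ?q + degree ?u" by (rule degree_mult_le)
    \<comment> \<open>Truncation does not raise the degree of the quotient, so the product has
      degree at most degree r' - degree r + degree u.\<close>
    then have "degree (?q * ?u) \<le> d - 1" using q nz False sum by fastforce
    moreover have "degree ?u' \<le> d - 1" using u' sum by linarith
    ultimately have "degree (?u' - ?q * ?u) \<le> d - 1" by (intro degree_diff_le)
    then show ?thesis using False d by (simp add: Delta2_def iB Let_def eea_q_def)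
  qed
  have d2: "1 \<le> d * d" using mult_le_mono[OF d d] by simp
  have "(if ?c \<le> 0 then 1 else div_cost ?r' ?r + mult_sub_cost ?u' ?q ?u) \<le> 7 * (d * d)"
  proof (cases "?c \<le> 0")
    case True
    then show ?thesis using d2 by simp
  next
    case False
    then have that: "0 < ?c" by simp
    have r: "degree ?r < degree ?r'" using ok nz[OF that] by (auto simp: eea_ok_def)
    have "degree ?r' + 1 \<le> d * d" "degree ?u' + 1 \<le> d * d"
      using u' sum d mult_le_mono1[OF d, of d] by linarith+
    moreover have "(degree ?r' + 1 - degree ?r) * (2 * degree ?r + 3) \<le> d * (3 * d)"
      using r sum d by (intro mult_le_mono) auto
    moreover have "2 * (degree ?q + 1) * (degree ?u + 1) \<le> (2 * d) * d"
      using q[OF nz[OF that]] sum d by (intro mult_le_mono) auto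
    ultimately have "div_cost ?r' ?r + mult_sub_cost ?u' ?q ?u \<le> 7 * (d * d)"
      unfolding div_cost_def mult_sub_cost_def by simp
    then show ?thesis using False by simp
  qed
  moreover have "b * (10 * d) \<le> 5 * (d * d)"
  proof -
    have "2 * b \<le> d" by (simp add: b_def)
    then have "2 * b * (5 * d) \<le> d * (5 * d)" by (rule mult_le_mono1)
    then show ?thesis by (simp add: mult.assoc mult.left_commute)
  qed
  ultimately show "time (basis_tm d S) \<le> 14 * d\<^sup>2"
    using time d2 unfolding basis power2_eq_square tm.sel by linarith
qed

section \<open>Computation of the matrix\<close>

lemma val_horner: "val (horner x cs) = poly (Poly cs) x"
  by (induction cs) (auto simp: bind_tm_def)

lemma time_horner: "time (horner x cs) = 3 * length cs + 1"
  by (induction cs) (auto simp: bind_tm_def)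

text \<open>The recurrence in \<open>row_tm\<close> is \<open>col_poly_shift\<close> evaluated at x:
  multiplication by x leads from the previous column or, beyond column 2 t1 + 1, from the one before
  it.\<close>

lemma val_row_tm:
  assumes t1: "1 \<le> t1" and "1 \<le> i" "i \<le> k"
  shows "val (row_tm t1 (poly D1 x) (poly D2 x) x k) i = poly (col_poly t1 D1 D2 i) x"
  using assms(2,3)
proof (induction k arbitrary: i)
  case (Suc k)
  show ?case
  proof (cases "i = Suc k")
    case False
    then show ?thesis using Suc by (simp add: bind_tm_def)
  next
    case True
    consider (first) "k = 0" | (low) "1 \<le> k" "k < 2 * t1" | (middle) "k = 2 * t1" "k \<noteq> 0"
      | (high) h where "k = Suc h" "2 * t1 \<le> h"
      by (metis One_nat_def Suc_leI le_less_Suc_eq less_Suc_eq_le linorder_neqE_nat not0_implies_Suc not_gr_zero not_less)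
    then show ?thesis
    proof cases
      case first
      then show ?thesis using True t1 by (simp add: bind_tm_def col_poly_def)
    next
      case low
      then show ?thesis using True Suc.IH[of k] by (simp add: bind_tm_def col_poly_shift(1)[OF t1])
    next
      case middle
      then show ?thesis using True by (simp add: bind_tm_def col_poly_def)
    next
      case high
      then show ?thesis using True t1 Suc.IH[of h]
        by (simp add: bind_tm_def col_poly_shift(2)[OF t1])
    qed
  qed
qed simp

lemma time_row_tm: "time (row_tm t1 y1 y2 x k) = 3 * k + 1"
  by (induction k) (auto simp: bind_tm_def)

lemma val_matrix_tm:
  assumes "1 \<le> t1" "1 \<le> i" "i \<le> k" "m < length xs"
  shows "(val (matrix_tm t1 D1 D2 k xs) ! m) i = poly (col_poly t1 D1 D2 i) (xs ! m)"
  using assms(4)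
proof (induction xs arbitrary: m)
  case (Cons x xs)
  then show ?case
    using val_row_tm[OF assms(1-3)] by (cases m) (simp_all add: bind_tm_def val_horner)
qed simp

lemma time_matrix_tm:
  "time (matrix_tm t1 D1 D2 k xs) =
     length xs * (3 * length (coeffs D1) + 3 * length (coeffs D2) + 3 * k + 4) + 1"
  by (induction xs) (auto simp: bind_tm_def time_horner time_row_tm)

lemma length_coeffs_le: "degree p < d \<Longrightarrow> length (coeffs p) \<le> d"
  by (cases "p = 0") (auto simp: length_coeffs_degree)

section \<open>From the syndrome to the list of solutions\<close>

lemma degree_syndrome: "syndrome \<alpha> n d w = 0 \<or> degree (syndrome \<alpha> n d w) < d - 1"
  unfolding syndrome_def
  using degree_mod_less[of "monom 1 (d - 1)" "spectrum \<alpha> n w"] by (simp add: degree_monom_eq)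

lemma candidate_locators_eq:
  "candidate_locators t1 D1 D2 xs \<tau> =
     represents t1 D1 D2 ` subsystem_solutions (eval_matrix t1 D1 D2 xs) \<tau>"
  by (auto simp: candidate_locators_def subsystem_solutions_def solves_eval_matrix)

text \<open>The bound collects 14 d^2 for the basis polynomials, 13 d^2 for the matrix and 2 d^2 for
  listing the solutions.\<close>

lemma gmd_tm_correct:
  fixes S :: "'a::field poly"
  assumes d: "1 \<le> d" and S: "S = 0 \<or> degree S < d - 1" and T: "2 * T \<le> d - 1"
    and len: "2 * T \<le> length xs"
  defines "run \<equiv> fia (modified_start (t_1 d S))
      (eval_matrix (t_1 d S) (Delta1 d S) (Delta2 d S) xs) (2 * T) (2 * T + 1)"
  shows "val (gmd_tm d S xs T) = map (fia_solutions (val run)) [0..<T + 1]"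
    and "time (gmd_tm d S xs T) \<le> 29 * d\<^sup>2 + time run"
proof -
  let ?t1 = "t_1 d S" and ?D1 = "Delta1 d S" and ?D2 = "Delta2 d S"
  let ?A = "eval_matrix ?t1 ?D1 ?D2 xs"
  let ?rows = "matrix_tm ?t1 ?D1 ?D2 (2 * T + 1) (take (2 * T) xs)"
  note basis = basis_tm_correct[OF d S]
  have T1: "2 * T + 1 \<le> d" using T d by linarith
  have "fia (modified_start ?t1) ?A (2 * T) (2 * T + 1) =
    fia (modified_start ?t1) (\<lambda>m i. (val ?rows ! (m - 1)) i) (2 * T) (2 * T + 1)"
    using len basis(5)
    by (intro fia_cong good_modified_start) (simp_all add: eval_matrix_def val_matrix_tm)
  then have gmd: "gmd_tm d S xs T =
      TM (map (fia_solutions (val run)) [0..<T + 1])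
        (time (basis_tm d S) + (time ?rows + (time run + (\<Sum>\<tau>\<le>T. 2 * (2 * \<tau> + 1)))))"
    by (simp add: gmd_tm_def bind_tm_def basis(1) collect_tm_def run_def del: fia.simps upt_Suc)
  show "val (gmd_tm d S xs T) = map (fia_solutions (val run)) [0..<T + 1]"
    by (simp add: gmd del: upt_Suc)
  have rows_eq: "time ?rows = 2 * T *
      (3 * length (coeffs ?D1) + 3 * length (coeffs ?D2) + 3 * (2 * T + 1) + 4) + 1"
    using len by (simp add: time_matrix_tm)
  have "degree ?D1 < d" using basis(3) d by linarith
  then have "length (coeffs ?D1) \<le> d" by (rule length_coeffs_le)
  then have "3 * length (coeffs ?D1) + 3 * length (coeffs ?D2) + 3 * (2 * T + 1) + 4
      \<le> 3 * d + 3 * d + 3 * d + 4 * d"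
    using T1 d by (intro add_mono mult_le_mono2 length_coeffs_le[OF basis(4)]) simp_all
  also have "\<dots> = 13 * d" by simp
  finally have "3 * length (coeffs ?D1) + 3 * length (coeffs ?D2) + 3 * (2 * T + 1) + 4 \<le> 13 * d" .
  then have "2 * T * (3 * length (coeffs ?D1) + 3 * length (coeffs ?D2) + 3 * (2 * T + 1) + 4)
      \<le> (d - 1) * (13 * d)"
    using T by (intro mult_le_mono)
  moreover note rows_eq
  \<comment> \<open>Since 2 T \<le> d - 1, the additive 1 in \<open>rows_eq\<close> fits into the
    remaining 13 d.\<close>
  moreover have "(d - 1) * (13 * d) + 13 * d = 13 * d\<^sup>2"
    using d by (cases d) (simp_all add: power2_eq_square algebra_simps)
  ultimately have rows: "time ?rows \<le> 13 * d\<^sup>2" using d by linarith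
  have "(\<Sum>\<tau>\<le>T. 2 * (2 * \<tau> + 1)) = 2 * (T + 1)\<^sup>2"
    by (induction T) (simp_all add: power2_eq_square)
  moreover have "(T + 1)\<^sup>2 \<le> d\<^sup>2" using T d by (intro power_mono) auto
  ultimately have "(\<Sum>\<tau>\<le>T. 2 * (2 * \<tau> + 1)) \<le> 2 * d\<^sup>2" by linarith
  with basis(2) rows show "time (gmd_tm d S xs T) \<le> 29 * d\<^sup>2 + time run"
    by (simp add: gmd)
qed

theorem mainTheorem1:
  fixes \<alpha> :: "'a::{field,finite}"
    and n k d T t1 :: nat
    and c e S D1 D2 :: "'a poly"
    and ps :: "nat list"
    and xs :: "'a list"
    and A :: "nat \<Rightarrow> nat \<Rightarrow> 'a"
    and run basic_run :: "nat \<Rightarrow> 'a fia_state tm"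
  assumes "has_order \<alpha> n"
    and "1 \<le> k" and "k \<le> n" and "d = n - k + 1"
    and "c \<in> rs_code \<alpha> n d" and "degree e < n"
    and "distinct ps" and "set ps = {..<n}"
    and "2 * T \<le> d - 1"
    and "S = syndrome \<alpha> n d (c + e)"
    and "t1 = t_1 d S" and "D1 = Delta1 d S" and "D2 = Delta2 d S"
    and "xs = locators \<alpha> ps"
    and "A = eval_matrix t1 D1 D2 xs"
    and "run = fia (modified_start t1) A (2 * T)"
    and "basic_run = fia basic_start A (2 * T)"
  shows "(degree D1 \<le> (d - 1) div 2 \<and> 1 \<le> t1 \<and>
       next_deg d S (i_B d S) = int ((d - 1) div 2 + t1)) \<and>
    (\<forall>v j. solves A j v \<longleftrightarrow> (\<forall>m\<in>{1..j}. poly (represents t1 D1 D2 v) (xs ! (m - 1)) = 0)) \<and>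
    (t1 = 1 \<longrightarrow> (\<forall>i j a\<^sub>1 a. length a = 2 * i \<and> j \<le> 2 * i \<and> solves A j (a\<^sub>1 # a) \<longrightarrow>
        pad t1 (a\<^sub>1 # a) = 0 # a\<^sub>1 # 0 # a \<and>
        length (0 # a\<^sub>1 # 0 # a) = 2 * i + 3 \<and>
        represents t1 D1 D2 (0 # a\<^sub>1 # 0 # a) = [:0, 1:] * represents t1 D1 D2 (a\<^sub>1 # a) \<and>
        solves A j (0 # a\<^sub>1 # 0 # a))) \<and>
    (\<forall>v. length v < 2 * t1 \<longrightarrow>
        represents t1 D1 D2 (0 # v) = [:0, 1:] * represents t1 D1 D2 v \<and>
        (\<forall>j. solves A j v \<longrightarrow> solves A j (0 # v))) \<and>
    (\<forall>v. 2 * t1 \<le> length v \<longrightarrow>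
        length (pad t1 v) = length v + 2 \<and>
        represents t1 D1 D2 (pad t1 v) = [:0, 1:] * represents t1 D1 D2 v \<and>
        (\<forall>j. solves A j v \<longrightarrow> solves A j (pad t1 v))) \<and>
    (\<forall>i\<in>{1..2 * T + 1}. \<forall>v j. val (modified_start t1 (val (run (i - 1))) i) = (v, j) \<longrightarrow>
        length v = i \<and> last v \<noteq> 0 \<and> 1 \<le> j \<and> j \<le> 2 * T + 1 \<and> solves A (j - 1) v) \<and>
    (finds_all_solutions A T (val (run (2 * T + 1)))) \<and>
    (finds_all_solutions A T (val (basic_run (2 * T + 1)))) \<and>
    (traversals 2 (trace (val (run (2 * T + 1))))) \<and>
    (traversals d (trace (val (basic_run (2 * T + 1))))) \<and>
    (time (run (2 * T + 1)) \<le> 200 * d ^ 2) \<and>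
    (time (basic_run (2 * T + 1)) \<le> 200 * d ^ 3) \<and>
    (val (gmd_tm d S xs T) = map (fia_solutions (val (run (2 * T + 1)))) [0..<T + 1]) \<and>
    (\<forall>\<tau>\<le>T. candidate_locators t1 D1 D2 xs \<tau> =
        represents t1 D1 D2 ` lin_span (2 * \<tau> + 1) (val (gmd_tm d S xs T) ! \<tau>)) \<and>
    (time (gmd_tm d S xs T) \<le> 200 * d ^ 2)"
proof -
  have d: "1 \<le> d" and T: "2 * T + 1 \<le> d" using assms(4,9) by linarith+
  have "length ps = n" using distinct_card[OF assms(7)] assms(8) by simp
  moreover have "2 * T \<le> n" using assms(2-4,9) by linarith
  ultimately have len: "2 * T \<le> length xs" by (simp add: assms(14) locators_def)
  have S: "S = 0 \<or> degree S < d - 1" unfolding assms(10) by (rule degree_syndrome)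
  note basis = basis_tm_correct[OF d S, folded assms(11-13)]
  have t1: "1 \<le> t1" by (rule basis(5))
  have good: "good_start A (2 * T) (modified_start t1)"
    unfolding assms(15) by (rule good_modified_start[OF t1])
  have good_basic: "good_start A (2 * T) basic_start" by (rule good_basic_start)
  have inv: "fia_inv A (2 * T) i (val (run i))" for i
    unfolding assms(16) by (rule fia_inv_fia[OF good])
  have inv_basic: "fia_inv A (2 * T) i (val (basic_run i))" for i
    unfolding assms(17) by (rule fia_inv_fia[OF good_basic])

  \<comment> \<open>Separation of the column classes and time bounds\<close>
  let ?parity = "\<lambda>i. if i \<le> 2 * t1 \<or> even i then 0 else 1 :: nat"
  have sep: "stop_row (modified_start t1) A (2 * T) i \<le> start_row (modified_start t1) A (2 * T) i'"
    if "1 \<le> i" "i < i'" "?parity i = ?parity i'" for i i'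
  proof (rule modified_start_classes[OF t1 good that(1,2)])
    show "(i \<le> 2 * t1 \<or> even i) = (i' \<le> 2 * t1 \<or> even i')"
      using that(3) by (metis zero_neq_one)
  qed
  \<comment> \<open>In the basic algorithm each column is a class of its own: 2 T + 1 \<le> d makes
    the residues distinct, and reducing modulo d keeps the class numbers below d for every
    index.\<close>
  have basic_sep: "stop_row basic_start A (2 * T) i \<le> start_row basic_start A (2 * T) i'"
    if "1 \<le> i" "i < i'" "i' \<le> 2 * T + 1" "(i - 1) mod d = (i' - 1) mod d" for i i'
  proof -
    have "i' \<le> d" using that(3) T by linarith
    then have "(i - 1) mod d = i - 1" "(i' - 1) mod d = i' - 1" using that(1,2) by simp_all
    then show ?thesis using that by simp
  qed

  \<comment> \<open>Here c is the number of classes; each class costs at most 11 d^2, and what does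
    not depend on the classes at most 10 d^2.\<close>
  have cost: "2 * T + 1 + (2 * T + 1) * (5 * (2 * T + 1) + 4) + c * (2 * T) * (6 * (2 * T + 1) + 5)
      \<le> 10 * d\<^sup>2 + 11 * (c * d\<^sup>2)" for c
  proof -
    have "2 * T + 1 \<le> d\<^sup>2" using T mult_le_mono[OF T d] by (simp add: power2_eq_square)
    moreover have "(2 * T + 1) * (5 * (2 * T + 1) + 4) \<le> d * (5 * d + 4 * d)"
      using d by (intro mult_le_mono add_mono T order_refl) simp_all
    moreover have "c * (2 * T) * (6 * (2 * T + 1) + 5) \<le> c * d * (6 * d + 5 * d)"
      using T d by (intro mult_le_mono add_mono order_refl) simp_all
    moreover have "d * (5 * d + 4 * d) = 9 * d\<^sup>2" "c * d * (6 * d + 5 * d) = 11 * (c * d\<^sup>2)"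
      by (simp_all add: power2_eq_square)
    ultimately show ?thesis by linarith
  qed
  have "time (run (2 * T + 1)) \<le> 2 * T + 1 + (2 * T + 1) * (5 * (2 * T + 1) + 4) +
      2 * (2 * T) * (6 * (2 * T + 1) + 5)"
    unfolding assms(16)
    by (rule time_fia[OF good time_modified_start, where f = ?parity]) (use sep in auto)
  also note cost[of 2]
  also have "10 * d\<^sup>2 + 11 * (2 * d\<^sup>2) = 32 * d\<^sup>2" by simp
  finally have time_run: "time (run (2 * T + 1)) \<le> 32 * d\<^sup>2" .
  have "time (basic_run (2 * T + 1)) \<le> 2 * T + 1 + (2 * T + 1) * (5 * (2 * T + 1) + 4) +
      d * (2 * T) * (6 * (2 * T + 1) + 5)"
    unfolding assms(17)
    by (rule time_fia[OF good_basic time_basic_start, where f = "\<lambda>i. (i - 1) mod d"])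
      (use basic_sep d in auto)
  also note cost[of d]
  also have "10 * d\<^sup>2 + 11 * (d * d\<^sup>2) \<le> 200 * d ^ 3"
  proof -
    have "d\<^sup>2 \<le> d ^ 3" using d by (intro power_increasing) auto
    moreover have "d * d\<^sup>2 = d ^ 3" by (simp add: power2_eq_square power3_eq_cube)
    ultimately show ?thesis by linarith
  qed
  finally have time_basic: "time (basic_run (2 * T + 1)) \<le> 200 * d ^ 3" .

  have gmd: "val (gmd_tm d S xs T) = map (fia_solutions (val (run (2 * T + 1)))) [0..<T + 1]"
    "time (gmd_tm d S xs T) \<le> 29 * d\<^sup>2 + time (run (2 * T + 1))"
    using gmd_tm_correct[OF d S assms(9) len, folded assms(11-13), folded assms(15), folded assms(16)]
    by (simp_all only: assms(16))
  have finds: "finds_all_solutions A T (val (run (2 * T + 1)))"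
    by (rule fia_inv_finds_all_solutions[OF inv])
  have cand: "candidate_locators t1 D1 D2 xs \<tau> =
      represents t1 D1 D2 ` lin_span (2 * \<tau> + 1) (val (gmd_tm d S xs T) ! \<tau>)" if "\<tau> \<le> T" for \<tau>
  proof -
    have "val (gmd_tm d S xs T) ! \<tau> = fia_solutions (val (run (2 * T + 1))) \<tau>"
      using that by (simp add: gmd(1) nth_map[of \<tau> "[0..<T + 1]"] del: upt_Suc)
    then show ?thesis
      using finds that unfolding finds_all_solutions_def
      by (simp add: candidate_locators_eq assms(15))
  qed

  have shift: "solves A j w"
    if "represents t1 D1 D2 w = [:0, 1:] * represents t1 D1 D2 v" "solves A j v" for v w j
    using solves_shifted[OF that(1)] that(2) unfolding assms(15) .
  have pad1: "pad t1 (a\<^sub>1 # a) = 0 # a\<^sub>1 # 0 # a" if "t1 = 1" for a\<^sub>1 a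
    using that by (simp add: pad_def)
  have rep1: "represents t1 D1 D2 (0 # a\<^sub>1 # 0 # a) = [:0, 1:] * represents t1 D1 D2 (a\<^sub>1 # a)"
    if "t1 = 1" "length a = 2 * i" for i a\<^sub>1 a
  proof (cases "i = 0")
    \<comment> \<open>A vector of length 1 is shorter than 2 t1 = 2, so
      \<open>represents_pad\<close> does not apply; the shift from column 1 to column 2 gives the
      claim, the third entry being zero.\<close>
    case True
    then show ?thesis
      using that col_poly_shift(1)[OF t1, of 1 D1 D2] by (simp add: represents_def lessThan_Suc)
  next
    case False
    then show ?thesis
      using represents_pad[OF t1, of "a\<^sub>1 # a"] that unfolding pad1[OF that(1)] by simp
  qed

  have c1: "degree D1 \<le> (d - 1) div 2 \<and> 1 \<le> t1 \<and>
      next_deg d S (i_B d S) = int ((d - 1) div 2 + t1)"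
    using basis(3,5,6) by blast
  have c2: "\<forall>v j. solves A j v \<longleftrightarrow> (\<forall>m\<in>{1..j}. poly (represents t1 D1 D2 v) (xs ! (m - 1)) = 0)"
    unfolding assms(15) solves_eval_matrix by blast
  have c3: "t1 = 1 \<longrightarrow> (\<forall>i j a\<^sub>1 a. length a = 2 * i \<and> j \<le> 2 * i \<and> solves A j (a\<^sub>1 # a) \<longrightarrow>
      pad t1 (a\<^sub>1 # a) = 0 # a\<^sub>1 # 0 # a \<and>
      length (0 # a\<^sub>1 # 0 # a) = 2 * i + 3 \<and>
      represents t1 D1 D2 (0 # a\<^sub>1 # 0 # a) = [:0, 1:] * represents t1 D1 D2 (a\<^sub>1 # a) \<and>
      solves A j (0 # a\<^sub>1 # 0 # a))"
  proof (intro allI impI, elim conjE)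
    fix i j a\<^sub>1 and a :: "'a list"
    assume t1: "t1 = 1" and a: "length a = 2 * i" "solves A j (a\<^sub>1 # a)"
    show "pad t1 (a\<^sub>1 # a) = 0 # a\<^sub>1 # 0 # a \<and>
      length (0 # a\<^sub>1 # 0 # a) = 2 * i + 3 \<and>
      represents t1 D1 D2 (0 # a\<^sub>1 # 0 # a) = [:0, 1:] * represents t1 D1 D2 (a\<^sub>1 # a) \<and>
      solves A j (0 # a\<^sub>1 # 0 # a)"
      by (intro conjI pad1[OF t1] rep1[OF t1 a(1)] shift[OF rep1[OF t1 a(1)] a(2)])
        (simp add: a(1))
  qed
  have c4: "\<forall>v. length v < 2 * t1 \<longrightarrow>
      represents t1 D1 D2 (0 # v) = [:0, 1:] * represents t1 D1 D2 v \<and>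
      (\<forall>j. solves A j v \<longrightarrow> solves A j (0 # v))"
    using represents_Cons_0[OF t1] shift by blast
  have c5: "\<forall>v. 2 * t1 \<le> length v \<longrightarrow>
      length (pad t1 v) = length v + 2 \<and>
      represents t1 D1 D2 (pad t1 v) = [:0, 1:] * represents t1 D1 D2 v \<and>
      (\<forall>j. solves A j v \<longrightarrow> solves A j (pad t1 v))"
    using length_pad[OF t1] represents_pad[OF t1] shift by blast
  have c6: "\<forall>i\<in>{1..2 * T + 1}. \<forall>v j. val (modified_start t1 (val (run (i - 1))) i) = (v, j) \<longrightarrow>
      length v = i \<and> last v \<noteq> 0 \<and> 1 \<le> j \<and> j \<le> 2 * T + 1 \<and> solves A (j - 1) v"
  proof (intro ballI allI impI)
    fix i v j
    assume i: "i \<in> {1..2 * T + 1}" and vj: "val (modified_start t1 (val (run (i - 1))) i) = (v, j)"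
    have "Suc (i - 1) = i" using i by simp
    then show "length v = i \<and> last v \<noteq> 0 \<and> 1 \<le> j \<and> j \<le> 2 * T + 1 \<and> solves A (j - 1) v"
      using good inv[of "i - 1"] vj unfolding good_start_def by metis
  qed
  have c8: "finds_all_solutions A T (val (basic_run (2 * T + 1)))"
    by (rule fia_inv_finds_all_solutions[OF inv_basic])
  have c9: "traversals 2 (trace (val (run (2 * T + 1))))"
    unfolding assms(16) by (rule traversals_fia[OF good, where f = ?parity]) (use sep in auto)
  have c10: "traversals d (trace (val (basic_run (2 * T + 1))))"
    unfolding assms(17)
    by (rule traversals_fia[OF good_basic, where f = "\<lambda>i. (i - 1) mod d"])
      (use basic_sep d in auto)
  have c11: "time (run (2 * T + 1)) \<le> 200 * d ^ 2" using time_run by simp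
  \<comment> \<open>The constants 29 and 32 add up to 61, well below 200.\<close>
  have c15: "time (gmd_tm d S xs T) \<le> 200 * d ^ 2" using gmd(2) time_run by simp
  have c14: "\<forall>\<tau>\<le>T. candidate_locators t1 D1 D2 xs \<tau> =
      represents t1 D1 D2 ` lin_span (2 * \<tau> + 1) (val (gmd_tm d S xs T) ! \<tau>)"
    using cand by blast
  show ?thesis
    by (rule conjI[OF c1 conjI[OF c2 conjI[OF c3 conjI[OF c4 conjI[OF c5 conjI[OF c6 conjI[OF finds
      conjI[OF c8 conjI[OF c9 conjI[OF c10 conjI[OF c11 conjI[OF time_basic conjI[OF gmd(1)
      conjI[OF c14 c15]]]]]]]]]]]]]])
qed

end
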